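(* Let $f$ be a transcendental entire function. If $f$ has a finite logarithmic asymptotic value $\alpha\in J(f)$, then $BU(f)\cup\{\infty\}$ is a connected subset of the Riemann sphere.
   Context: For an entire function $f$, $f^n$ denotes its $n$-th iterate; $J(f)$ is the Julia set (points in no neighbourhood of which $(f^n)$ is normal). The escaping set is $I(f) := \{z : f^n(z)\to\infty\}$, the bounded orbit set is $BO(f) := \{z : \exists K>0,\ |f^n(z)|<K \ \forall n\ge0\}$, and the bungee set is $BU(f) := \mathbb{C}\setminus(I(f)\cup BO(f))$. Write $B(a,r)=\{z:|z-a|<r\}$. A value $\alpha\in\mathbb{C}$ is a finite logarithmic asymptotic value of $f$ if there exist $r>0$ and a component $U$ of $f^{-1}(B(\alpha,r))$ such that the restriction $f: U\to B(\alpha,r)\setminus\{\alpha\}$ is a universal covering. *)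

theory Defs
  imports "HOL-Complex_Analysis.Complex_Analysis" "HOL-Computational_Algebra.Polynomial"
begin

definition transcendental_entire :: "(complex \<Rightarrow> complex) \<Rightarrow> bool" where
  "transcendental_entire f \<longleftrightarrow> f holomorphic_on UNIV \<and> \<not> (\<exists>p. \<forall>z. f z = poly p z)"

definition normal_family_on :: "(complex \<Rightarrow> complex) set \<Rightarrow> complex set \<Rightarrow> bool" where
  "normal_family_on F S \<longleftrightarrow>
     (\<forall>g :: nat \<Rightarrow> complex \<Rightarrow> complex. (\<forall>n. g n \<in> F) \<longrightarrow>
        (\<exists>r. strict_mono r \<and>
          ((\<exists>h. \<forall>K. K \<subseteq> S \<and> compact K \<longrightarrow> uniform_limit K (\<lambda>n. g (r n)) h sequentially)
           \<or> (\<forall>K. K \<subseteq> S \<and> compact K \<longrightarrow>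
                (\<forall>B. \<forall>\<^sub>F n in sequentially. \<forall>z\<in>K. B \<le> norm (g (r n) z))))))"

definition fatou_set :: "(complex \<Rightarrow> complex) \<Rightarrow> complex set" where
  "fatou_set f = {z. \<exists>U. open U \<and> z \<in> U \<and> normal_family_on (range (\<lambda>n. f ^^ n)) U}"

definition julia_set :: "(complex \<Rightarrow> complex) \<Rightarrow> complex set" where
  "julia_set f = - fatou_set f"

definition escaping_set :: "(complex \<Rightarrow> complex) \<Rightarrow> complex set" where
  "escaping_set f = {z. filterlim (\<lambda>n. (f ^^ n) z) at_infinity sequentially}"

definition bounded_orbit_set :: "(complex \<Rightarrow> complex) \<Rightarrow> complex set" where
  "bounded_orbit_set f = {z. \<exists>K>0. \<forall>n. norm ((f ^^ n) z) < K}"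

definition bungee_set :: "(complex \<Rightarrow> complex) \<Rightarrow> complex set" where
  "bungee_set f = - (escaping_set f \<union> bounded_orbit_set f)"

definition finite_log_asymptotic_value :: "(complex \<Rightarrow> complex) \<Rightarrow> complex \<Rightarrow> bool" where
  "finite_log_asymptotic_value f \<alpha> \<longleftrightarrow>
     (\<exists>r>0. \<exists>U. U \<in> components (f -` ball \<alpha> r) \<and> simply_connected U \<and>
        covering_space U f (ball \<alpha> r - {\<alpha>}))"

text \<open>Riemann sphere, realised as the unit sphere in complex x real via inverse
  stereographic projection; infinity corresponds to the north pole (0,1).\<close>
definition sphere_of :: "complex \<Rightarrow> complex \<times> real" where
  "sphere_of z = (of_real (2 / (1 + (cmod z)\<^sup>2)) * z, ((cmod z)\<^sup>2 - 1) / ((cmod z)\<^sup>2 + 1))"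

definition sphere_infinity :: "complex \<times> real" where
  "sphere_infinity = (0, 1)"

end

theory Submission
  imports
    Defs
    "HOL-Probability.Probability_Measure"
    "HOL-Real_Asymp.Real_Asymp"
begin

text \<open>If \<open>BU(f) \<union> {\<infinity>}\<close> were disconnected, there would be a bounded open set \<open>G\<close> meeting
  \<open>BU(f)\<close> whose frontier misses it.

  If \<open>G\<close> meets \<open>J(f)\<close>, then by Montel some iterate of \<open>G\<close>, with its holes filled, contains a large
  disc, and the outer frontier of that iterate must cross the tract over \<open>\<alpha>\<close>. Because \<open>f\<close> omits \<open>\<alpha>\<close>
  on the closure of the tract, the image of this frontier separates \<open>\<alpha>\<close> from the circle of radius
  \<open>r/2\<close>, hence contains the frontier of a domain around \<open>\<alpha> \<in> J(f)\<close>. Repeating this, nested compact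
  sets give a point of the frontier of \<open>G\<close> whose orbit is alternately very large and close to \<open>\<alpha>\<close>.

  Otherwise a component of \<open>G\<close> is a bounded wandering domain in \<open>BU(f)\<close> with frontier in \<open>J(f)\<close>.
  The first argument also shows that no continuum in the Fatou set encloses a Julia point, so this
  domain and its images are simply connected. Then almost every frontier point, with respect to
  harmonic measure, has a bungee orbit: a disc omitted by the iterates keeps the bounded ones
  bounded, and a square root branch on a simply connected domain containing a far image keeps the
  large ones large.\<close>

section \<open>Compact convergence and normality\<close>

definition converges_compactly_on ::
    "'a::topological_space set \<Rightarrow> (nat \<Rightarrow> 'a \<Rightarrow> 'b::metric_space) \<Rightarrow> ('a \<Rightarrow> 'b) \<Rightarrow> bool" where
  "converges_compactly_on S g h \<longleftrightarrow>
     (\<forall>K. K \<subseteq> S \<and> compact K \<longrightarrow> uniform_limit K g h sequentially)"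

definition escapes_compactly_on ::
    "'a::topological_space set \<Rightarrow> (nat \<Rightarrow> 'a \<Rightarrow> 'b::real_normed_vector) \<Rightarrow> bool" where
  "escapes_compactly_on S g \<longleftrightarrow>
     (\<forall>K. K \<subseteq> S \<and> compact K \<longrightarrow> (\<forall>B. \<forall>\<^sub>F n in sequentially. \<forall>z\<in>K. B \<le> norm (g n z)))"

definition spherically_convergent_on ::
    "'a::topological_space set \<Rightarrow> (nat \<Rightarrow> 'a \<Rightarrow> 'b::real_normed_vector) \<Rightarrow> bool" where
  "spherically_convergent_on S g \<longleftrightarrow>
     (\<exists>h. converges_compactly_on S g h) \<or> escapes_compactly_on S g"

lemma spherically_convergent_onE:
  assumes "spherically_convergent_on S g"
  obtains (converges) h where "converges_compactly_on S g h" | (escapes) "escapes_compactly_on S g"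
  using assms unfolding spherically_convergent_on_def by blast

lemma converges_compactly_onD:
  "\<lbrakk>converges_compactly_on S g h; K \<subseteq> S; compact K\<rbrakk> \<Longrightarrow> uniform_limit K g h sequentially"
  by (simp add: converges_compactly_on_def)

lemma escapes_compactly_onD:
  "\<lbrakk>escapes_compactly_on S g; K \<subseteq> S; compact K\<rbrakk>
    \<Longrightarrow> \<forall>\<^sub>F n in sequentially. \<forall>z\<in>K. B \<le> norm (g n z)"
  by (simp add: escapes_compactly_on_def)

lemma normal_family_on_iff:
  "normal_family_on F S \<longleftrightarrow>
     (\<forall>g :: nat \<Rightarrow> complex \<Rightarrow> complex. range g \<subseteq> F \<longrightarrow>
       (\<exists>r. strict_mono r \<and> spherically_convergent_on S (\<lambda>n. g (r n))))"
  by (simp add: normal_family_on_def spherically_convergent_on_def converges_compactly_on_def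
      escapes_compactly_on_def image_subset_iff)

lemma converges_compactly_on_subseq:
  assumes "converges_compactly_on S g h" "strict_mono r"
  shows "converges_compactly_on S (\<lambda>n. g (r n)) h"
  using assms filterlim_compose filterlim_subseq unfolding converges_compactly_on_def by blast

lemma escapes_compactly_on_subseq:
  assumes "escapes_compactly_on S g" "strict_mono r"
  shows "escapes_compactly_on S (\<lambda>n. g (r n))"
  using assms eventually_subseq unfolding escapes_compactly_on_def by blast

lemma spherically_convergent_on_subseq:
  assumes "spherically_convergent_on S g" "strict_mono r"
  shows "spherically_convergent_on S (\<lambda>n. g (r n))"
  using assms converges_compactly_on_subseq escapes_compactly_on_subseq
  unfolding spherically_convergent_on_def by blast

lemma converges_compactly_on_continuous_limit:
  assumes "converges_compactly_on S g h" "\<And>n. continuous_on S (g n)" "K \<subseteq> S" "compact K"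
  shows "continuous_on K h"
  by (rule uniform_limit_theorem[OF _ converges_compactly_onD[OF assms(1,3,4)]])
     (use assms in \<open>auto intro: continuous_on_subset always_eventually\<close>)

lemma converges_compactly_on_inverse:
  fixes F :: "nat \<Rightarrow> 'a::topological_space \<Rightarrow> 'b::real_normed_field"
  assumes conv: "converges_compactly_on S F g" and cont: "continuous_on S g"
    and nz: "\<And>z. z \<in> S \<Longrightarrow> g z \<noteq> 0"
  shows "converges_compactly_on S (\<lambda>n z. inverse (F n z)) (\<lambda>z. inverse (g z))"
  unfolding converges_compactly_on_def
proof (intro allI impI)
  fix K assume K: "K \<subseteq> S \<and> compact K"
  show "uniform_limit K (\<lambda>n z. inverse (F n z)) (\<lambda>z. inverse (g z)) sequentially"
  proof (cases "K = {}")
    case False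
    have "continuous_on K (\<lambda>z. norm (g z))"
      using cont K by (intro continuous_intros) (auto intro: continuous_on_subset)
    then obtain x where x: "x \<in> K" "\<And>y. y \<in> K \<Longrightarrow> norm (g x) \<le> norm (g y)"
      using continuous_attains_inf K False by metis
    show ?thesis
      by (rule uniform_lim_inverse[where b = "norm (g x)", unfolded o_def])
         (use x K nz conv in \<open>auto intro: converges_compactly_onD\<close>)
  qed auto
qed

lemma escapes_compactly_on_inverse:
  fixes F :: "nat \<Rightarrow> 'a::topological_space \<Rightarrow> 'b::real_normed_field"
  assumes conv: "converges_compactly_on S F (\<lambda>z. 0)" and nz: "\<And>n z. z \<in> S \<Longrightarrow> F n z \<noteq> 0"
  shows "escapes_compactly_on S (\<lambda>n z. inverse (F n z))"
  unfolding escapes_compactly_on_def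
proof (intro allI impI)
  fix K and B :: real assume K: "K \<subseteq> S \<and> compact K"
  have "\<forall>\<^sub>F n in sequentially. \<forall>z\<in>K. dist (F n z) 0 < 1 / (\<bar>B\<bar> + 1)"
    using conv K by (intro uniform_limitD converges_compactly_onD) auto
  then show "\<forall>\<^sub>F n in sequentially. \<forall>z\<in>K. B \<le> norm (inverse (F n z))"
  proof eventually_elim
    case (elim n)
    have "B \<le> inverse (norm (F n z))" if "z \<in> K" for z
    proof -
      have "F n z \<noteq> 0" "norm (F n z) < 1 / (\<bar>B\<bar> + 1)" using elim K nz that by auto
      then have "\<bar>B\<bar> + 1 < inverse (norm (F n z))"
        using less_imp_inverse_less[of "norm (F n z)" "1 / (\<bar>B\<bar> + 1)"] by simp
      then show ?thesis by linarith
    qed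
    then show ?case by (simp add: norm_inverse)
  qed
qed

lemma spherically_convergent_on_inverse:
  assumes S: "open S" "connected S"
    and F: "\<And>n. F n holomorphic_on S" "\<And>n z. z \<in> S \<Longrightarrow> F n z \<noteq> 0"
    and g: "g holomorphic_on S" and conv: "converges_compactly_on S F g"
  shows "spherically_convergent_on S (\<lambda>n z. inverse (F n z))"
proof (cases "\<exists>z\<in>S. g z = 0")
  case True
  then obtain z where z: "z \<in> S" "g z = 0" by blast
  have "g constant_on S"
  proof (rule ccontr)
    assume "\<not> g constant_on S"
    then have "g z \<noteq> 0"
      using converges_compactly_onD[OF conv] F(2) z(1) by (intro Hurwitz_no_zeros[OF S F(1) g])
    then show False using z(2) by simp
  qed
  then have "g x = 0" if "x \<in> S" for x using z that unfolding constant_on_def by metis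
  then have "converges_compactly_on S F (\<lambda>z. 0)"
    using conv unfolding converges_compactly_on_def by (metis subsetD uniform_limit_cong')
  then show ?thesis
    using escapes_compactly_on_inverse F(2) unfolding spherically_convergent_on_def by blast
next
  case False
  then show ?thesis
    using converges_compactly_on_inverse[OF conv] g holomorphic_on_imp_continuous_on
    unfolding spherically_convergent_on_def by blast
qed

lemma converges_compactly_on_affine:
  fixes p a :: "nat \<Rightarrow> 'b::real_normed_field"
  assumes h: "converges_compactly_on S h u" "\<And>n. continuous_on S (h n)"
    and p: "p \<longlonglongrightarrow> l" and a: "a \<longlonglongrightarrow> m"
  shows "converges_compactly_on S (\<lambda>n z. p n + a n * h n z) (\<lambda>z. l + m * u z)"
  unfolding converges_compactly_on_def
proof (intro allI impI)
  fix K assume K: "K \<subseteq> S \<and> compact K"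
  have const: "uniform_limit K (\<lambda>n z. q n) (\<lambda>z. c) sequentially" if "q \<longlonglongrightarrow> c" for q and c :: 'b
    using tendstoD[OF that] by (auto simp: uniform_limit_iff elim!: eventually_mono)
  show "uniform_limit K (\<lambda>n z. p n + a n * h n z) (\<lambda>z. l + m * u z) sequentially"
  proof (intro uniform_limit_add uniform_lim_mult)
    have "continuous_on K u" using converges_compactly_on_continuous_limit[OF h] K by blast
    then show "bounded (u ` K)" using K by (simp add: compact_continuous_image compact_imp_bounded)
    show "bounded ((\<lambda>z. m) ` K)" by (rule bounded_subset[of "{m}"]) auto
  qed (use h(1) K const p a in \<open>auto intro: converges_compactly_onD\<close>)
qed

lemma escapes_compactly_on_affine:
  fixes p a :: "nat \<Rightarrow> 'b::real_normed_field"
  assumes h: "escapes_compactly_on S h" and p: "p \<longlonglongrightarrow> l" and a: "a \<longlonglongrightarrow> m" "m \<noteq> 0"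
  shows "escapes_compactly_on S (\<lambda>n z. p n + a n * h n z)"
  unfolding escapes_compactly_on_def
proof (intro allI impI)
  fix K and B :: real assume K: "K \<subseteq> S \<and> compact K"
  have "\<forall>\<^sub>F n in sequentially. norm (p n) < norm l + 1"
    using tendsto_norm[OF p] by (intro order_tendstoD) auto
  moreover have "\<forall>\<^sub>F n in sequentially. norm m / 2 < norm (a n)"
    using tendsto_norm[OF a(1)] a(2) by (intro order_tendstoD) auto
  moreover have "\<forall>\<^sub>F n in sequentially. \<forall>z\<in>K. (\<bar>B\<bar> + norm l + 1) / (norm m / 2) \<le> norm (h n z)"
    using escapes_compactly_onD[OF h] K by blast
  ultimately show "\<forall>\<^sub>F n in sequentially. \<forall>z\<in>K. B \<le> norm (p n + a n * h n z)"
  proof eventually_elim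
    case (elim n)
    have "B \<le> norm (p n + a n * h n z)" if z: "z \<in> K" for z
    proof -
      have "\<bar>B\<bar> + norm l + 1 = norm m / 2 * ((\<bar>B\<bar> + norm l + 1) / (norm m / 2))"
        using a(2) by simp
      also have "\<dots> \<le> norm (a n) * norm (h n z)"
        using elim z by (intro mult_mono) auto
      finally show ?thesis
        using norm_diff_ineq[of "a n * h n z" "p n"] elim(1) by (simp add: norm_mult add.commute)
    qed
    then show ?case by blast
  qed
qed

lemma spherically_convergent_on_affine:
  fixes p a :: "nat \<Rightarrow> 'b::real_normed_field"
  assumes "spherically_convergent_on S h" "\<And>n. continuous_on S (h n)"
    and "p \<longlonglongrightarrow> l" "a \<longlonglongrightarrow> m" "m \<noteq> 0"
  shows "spherically_convergent_on S (\<lambda>n z. p n + a n * h n z)"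
  using assms(1)
proof (cases rule: spherically_convergent_onE)
  case converges
  from converges_compactly_on_affine[OF this assms(2-4)] show ?thesis
    unfolding spherically_convergent_on_def by blast
next
  case escapes
  from escapes_compactly_on_affine[OF this assms(3-5)] show ?thesis
    unfolding spherically_convergent_on_def by blast
qed

lemma Montel_omitting_01_bounded_at:
  assumes S: "open S" "connected S" "w \<in> S"
    and F: "\<And>n. F n holomorphic_on S" "\<And>n z. z \<in> S \<Longrightarrow> F n z \<noteq> 0 \<and> F n z \<noteq> 1"
    and w: "\<And>n. norm (F n w) \<le> 1"
  obtains g r where "g holomorphic_on S" "strict_mono (r :: nat \<Rightarrow> nat)"
    "converges_compactly_on S (\<lambda>n. F (r n)) g"
proof -
  have bdd: "\<exists>B. \<forall>h\<in>range F. \<forall>z\<in>K. norm (h z) \<le> B" if K: "compact K" "K \<subseteq> S" for K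
  proof -
    obtain B where "\<And>h z. \<lbrakk>h \<in> range F; z \<in> K\<rbrakk> \<Longrightarrow> norm (h z) \<le> B"
      by (rule GPicard3[OF S, of "range F" "range F" K]) (use F w K in auto)
    then show ?thesis by blast
  qed
  have hol: "h holomorphic_on S" if "h \<in> range F" for h using F(1) that by blast
  show ?thesis
    by (rule Montel[OF S(1) hol bdd order_refl])
       (auto intro!: that simp: converges_compactly_on_def o_def)
qed

lemma Montel_omitting_01:
  assumes S: "open S" "connected S"
    and h: "\<And>n. h n holomorphic_on S" "\<And>n z. z \<in> S \<Longrightarrow> h n z \<noteq> 0 \<and> h n z \<noteq> 1"
  obtains r where "strict_mono (r :: nat \<Rightarrow> nat)" "spherically_convergent_on S (\<lambda>n. h (r n))"
proof (cases "S = {}")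
  case True
  then show ?thesis
    by (intro that[of id])
       (auto simp: strict_mono_id spherically_convergent_on_def converges_compactly_on_def)
next
  case False
  then obtain w where w: "w \<in> S" by blast
  have "{n. norm (h n w) \<le> 1} \<union> {n. norm (inverse (h n w)) \<le> 1} = UNIV"
    by (auto simp: norm_inverse inverse_le_1_iff)
  then consider "infinite {n. norm (h n w) \<le> 1}" | "infinite {n. norm (inverse (h n w)) \<le> 1}"
    by (metis finite_Un infinite_UNIV_nat)
  then show ?thesis
  proof cases
    case 1
    then obtain s :: "nat \<Rightarrow> nat" where s: "strict_mono s" "\<And>n. norm (h (s n) w) \<le> 1"
      using infinite_enumerate by blast
    obtain g r where "strict_mono (r :: nat \<Rightarrow> nat)" "converges_compactly_on S (\<lambda>n. h (s (r n))) g"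
      by (rule Montel_omitting_01_bounded_at[of S w "\<lambda>n. h (s n)"]) (use S w h s in auto)
    then show ?thesis
      using that[of "s \<circ> r"] s(1) by (auto simp: spherically_convergent_on_def strict_mono_o)
  next
    case 2
    then obtain s :: "nat \<Rightarrow> nat" where s: "strict_mono s" "\<And>n. norm (inverse (h (s n) w)) \<le> 1"
      using infinite_enumerate by blast
    define F where "F n z = inverse (h (s n) z)" for n z
    have F: "F n holomorphic_on S" "z \<in> S \<Longrightarrow> F n z \<noteq> 0 \<and> F n z \<noteq> 1" for n z
      using h unfolding F_def by (auto intro!: holomorphic_intros simp: inverse_eq_1_iff)
    obtain g r where g: "g holomorphic_on S" and r: "strict_mono (r :: nat \<Rightarrow> nat)"
      and conv: "converges_compactly_on S (\<lambda>n. F (r n)) g"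
      by (rule Montel_omitting_01_bounded_at[of S w F]) (use S w F s in \<open>auto simp: F_def\<close>)
    have "spherically_convergent_on S (\<lambda>n z. inverse (F (r n) z))"
      by (rule spherically_convergent_on_inverse[OF S _ _ g conv]) (use F in auto)
    then show ?thesis
      using that[of "s \<circ> r"] s(1) r by (simp add: F_def strict_mono_o)
  qed
qed

(* Normalising the omitted pair to 0 and 1 reduces to Montel's theorem, once the pairs converge. *)
lemma normal_family_on_omitting_bounded_separated_pairs:
  assumes S: "open S" "connected S" and hol: "\<And>h. h \<in> F \<Longrightarrow> h holomorphic_on S"
    and "\<delta> > 0"
    and omit: "\<And>h. h \<in> F \<Longrightarrow>
      \<exists>p q. norm p \<le> M \<and> norm q \<le> M \<and> \<delta> \<le> norm (q - p) \<and> p \<notin> h ` S \<and> q \<notin> h ` S"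
  shows "normal_family_on F S"
  unfolding normal_family_on_iff
proof (intro allI impI)
  fix g :: "nat \<Rightarrow> complex \<Rightarrow> complex" assume g: "range g \<subseteq> F"
  then have "\<forall>n. \<exists>p q. norm p \<le> M \<and> norm q \<le> M \<and> \<delta> \<le> norm (q - p) \<and>
      p \<notin> g n ` S \<and> q \<notin> g n ` S"
    using omit by blast
  then obtain p q where pq: "\<And>n. norm (p n) \<le> M" "\<And>n. norm (q n) \<le> M"
      "\<And>n. \<delta> \<le> norm (q n - p n)" "\<And>n. p n \<notin> g n ` S" "\<And>n. q n \<notin> g n ` S"
    by metis
  have "compact (cball (0::complex) M \<times> cball (0::complex) M)"
    by (intro compact_Times compact_cball)
  then obtain l s where s: "strict_mono (s :: nat \<Rightarrow> nat)" and lim: "(\<lambda>n. (p (s n), q (s n))) \<longlonglongrightarrow> l"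
    using pq(1,2) unfolding compact_eq_seq_compact_metric
    by (auto elim!: seq_compactE[where f = "\<lambda>n. (p n, q n)"] simp: o_def)
  have p: "(\<lambda>n. p (s n)) \<longlonglongrightarrow> fst l" and d: "(\<lambda>n. q (s n) - p (s n)) \<longlonglongrightarrow> snd l - fst l"
    using tendsto_fst[OF lim] tendsto_snd[OF lim] by (auto intro: tendsto_diff)
  have "\<delta> \<le> norm (snd l - fst l)"
    by (rule LIMSEQ_le_const[OF tendsto_norm[OF d]]) (use pq(3) in auto)
  then have d_nz: "snd l - fst l \<noteq> 0" using \<open>\<delta> > 0\<close> by auto
  define h where "h n z = (g (s n) z - p (s n)) / (q (s n) - p (s n))" for n z
  have q_ne_p: "q n \<noteq> p n" for n using pq(3)[of n] \<open>\<delta> > 0\<close> by auto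
  then have h_hol: "h n holomorphic_on S" for n
    unfolding h_def using hol g by (intro holomorphic_intros) (auto simp: image_subset_iff)
  have h_omit: "h n z \<noteq> 0 \<and> h n z \<noteq> 1" if "z \<in> S" for n z
  proof -
    have "g (s n) z \<noteq> p (s n)" "g (s n) z \<noteq> q (s n)" using pq(4,5) imageI[OF that] by metis+
    then show ?thesis using q_ne_p[of "s n"] by (simp add: h_def)
  qed
  obtain r where r: "strict_mono (r :: nat \<Rightarrow> nat)" "spherically_convergent_on S (\<lambda>n. h (r n))"
    by (rule Montel_omitting_01[OF S h_hol h_omit])
  have "spherically_convergent_on S (\<lambda>n z. p (s (r n)) + (q (s (r n)) - p (s (r n))) * h (r n) z)"
    by (rule spherically_convergent_on_affine[OF r(2) _ _ _ d_nz])
       (use h_hol p d LIMSEQ_subseq_LIMSEQ[OF _ r(1)] in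
         \<open>auto intro: holomorphic_on_imp_continuous_on simp: o_def\<close>)
  then have "spherically_convergent_on S (\<lambda>n. g ((s \<circ> r) n))"
    using q_ne_p by (simp add: h_def)
  then show "\<exists>r. strict_mono r \<and> spherically_convergent_on S (\<lambda>n. g (r n))"
    using strict_mono_o[OF s r(1)] by blast
qed

section \<open>Iterates\<close>

lemma holomorphic_on_funpow:
  assumes "f holomorphic_on UNIV"
  shows "(f ^^ n) holomorphic_on S"
proof -
  have "(f ^^ n) holomorphic_on UNIV"
  proof (induction n)
    case (Suc n)
    show ?case
      unfolding funpow.simps
      using holomorphic_on_compose[OF Suc] assms holomorphic_on_subset by blast
  qed (simp add: id_def)
  then show ?thesis using holomorphic_on_subset by blast
qed

lemma continuous_on_funpow:
  fixes f :: "'a::topological_space \<Rightarrow> 'a"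
  assumes "continuous_on UNIV f"
  shows "continuous_on S (f ^^ n)"
proof -
  have "continuous_on UNIV (f ^^ n)"
  proof (induction n)
    case (Suc n)
    show ?case
      unfolding funpow.simps using continuous_on_compose[OF Suc] assms continuous_on_subset by blast
  qed (simp add: id_def)
  then show ?thesis using continuous_on_subset by blast
qed

lemma open_funpow_image:
  fixes f :: "'a::topological_space \<Rightarrow> 'a"
  assumes "\<And>S. open S \<Longrightarrow> open (f ` S)" "open S"
  shows "open ((f ^^ n) ` S)"
proof (induction n)
  case (Suc n)
  then have "open (f ` (f ^^ n) ` S)" by (rule assms(1))
  then show ?case by (simp add: image_comp)
qed (use assms(2) in simp)

lemma funpow_itinerary:
  fixes f :: "'a::heine_borel \<Rightarrow> 'a"
  assumes f: "continuous_on UNIV f"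
    and E: "\<And>i. compact (E i)" "\<And>i. E i \<noteq> {}" "\<And>i. E (Suc i) \<subseteq> (f ^^ k i) ` E i"
  obtains z where "\<And>i. (f ^^ (\<Sum>j<i. k j)) z \<in> E i"
proof -
  define s where "s i = (\<Sum>j<i. k j)" for i
  define X where "X N = E 0 \<inter> (\<Inter>i\<le>N. (f ^^ s i) -` E i)" for N
  have reach: "E N \<subseteq> (f ^^ s N) ` X N" for N
  proof (induction N)
    case 0
    then show ?case by (auto simp: X_def s_def)
  next
    case (Suc N)
    show ?case
    proof
      fix v assume v: "v \<in> E (Suc N)"
      then obtain x where x: "x \<in> X N" "v = (f ^^ k N) ((f ^^ s N) x)" using E(3) Suc by blast
      have "s (Suc N) = k N + s N" by (simp add: s_def)
      then have "v = (f ^^ s (Suc N)) x" using x(2) by (simp add: funpow_add)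
      moreover from this have "x \<in> X (Suc N)" using x(1) v by (simp add: X_def atMost_Suc)
      ultimately show "v \<in> (f ^^ s (Suc N)) ` X (Suc N)" by blast
    qed
  qed
  have "compact (X N)" for N
    unfolding X_def using E(1)
    by (intro compact_Int_closed closed_INT ballI closed_vimage continuous_on_funpow[OF f])
       (auto intro: compact_imp_closed)
  moreover have "X N \<noteq> {}" for N using reach[of N] E(2)[of N] by blast
  moreover have "X N \<subseteq> X M" if "M \<le> N" for M N using that by (force simp: X_def)
  ultimately have "\<Inter>(range X) \<noteq> {}" by (rule compact_nest)
  then obtain z where z: "\<And>N. z \<in> X N" by blast
  then have "(f ^^ s i) z \<in> E i" for i using z[of i] unfolding X_def by blast
  then show ?thesis using that unfolding s_def by blast
qed

section \<open>Bungee orbits\<close>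

lemma escaping_set_iff:
  "z \<in> escaping_set f \<longleftrightarrow> (\<forall>K. \<forall>\<^sub>F n in sequentially. K \<le> norm ((f ^^ n) z))"
  by (simp add: escaping_set_def filterlim_at_infinity_conv_norm_at_top filterlim_at_top)

lemma bounded_orbit_set_iff: "z \<in> bounded_orbit_set f \<longleftrightarrow> (\<exists>K. \<forall>n. norm ((f ^^ n) z) < K)"
proof -
  have "K > 0" if "\<forall>n. norm ((f ^^ n) z) < K" for K
    using that norm_ge_zero le_less_trans by blast
  then show ?thesis unfolding bounded_orbit_set_def by blast
qed

lemma bungee_set_iff:
  "z \<in> bungee_set f \<longleftrightarrow>
     (\<exists>K. \<exists>\<^sub>F n in sequentially. norm ((f ^^ n) z) < K) \<and> (\<forall>K. \<exists>n. K \<le> norm ((f ^^ n) z))"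
  by (auto simp: bungee_set_def escaping_set_iff bounded_orbit_set_iff
      not_eventually not_le not_less)

lemma bungee_setI:
  assumes "\<And>n. \<exists>k\<ge>n. norm ((f ^^ k) z) \<le> K" and "\<And>n::nat. \<exists>k. real n \<le> norm ((f ^^ k) z)"
  shows "z \<in> bungee_set f"
  unfolding bungee_set_iff frequently_sequentially
proof (intro conjI allI exI[of _ "K + 1"])
  show "\<exists>k\<ge>n. norm ((f ^^ k) z) < K + 1" for n using assms(1)[of n] by force
  show "\<exists>n. B \<le> norm ((f ^^ n) z)" for B using real_arch_simple[of B] assms(2) order_trans by blast
qed

lemma image_in_bungee_set_iff: "f z \<in> bungee_set f \<longleftrightarrow> z \<in> bungee_set f"
proof -
  have shift: "(f ^^ n) (f z) = (f ^^ Suc n) z" for n by (simp add: funpow_swap1)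
  have "f z \<in> escaping_set f \<longleftrightarrow> z \<in> escaping_set f"
    unfolding escaping_set_def mem_Collect_eq shift by (rule filterlim_sequentially_Suc)
  moreover have "z \<in> bounded_orbit_set f" if "f z \<in> bounded_orbit_set f"
  proof -
    from that obtain K where "\<And>n. norm ((f ^^ Suc n) z) < K"
      unfolding bounded_orbit_set_iff shift by blast
    then have "norm ((f ^^ n) z) < max K (norm z + 1)" for n
      by (cases n) (auto simp: less_max_iff_disj)
    then show ?thesis unfolding bounded_orbit_set_iff by blast
  qed
  moreover have "f z \<in> bounded_orbit_set f" if "z \<in> bounded_orbit_set f"
    using that unfolding bounded_orbit_set_iff shift by blast
  ultimately show ?thesis by (auto simp: bungee_set_def)
qed

lemma funpow_in_bungee_set_iff: "(f ^^ n) z \<in> bungee_set f \<longleftrightarrow> z \<in> bungee_set f"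
  by (induction n) (simp_all add: image_in_bungee_set_iff)

section \<open>Topological preliminaries\<close>

lemma norm_le_if_mem_cball:
  fixes x :: "'a::real_normed_vector"
  assumes "x \<in> cball a r"
  shows "norm x \<le> norm a + r"
  using assms norm_triangle_ineq2[of x a] by (simp add: dist_norm norm_minus_commute)

lemma bounded_continuous_image:
  fixes h :: "'a::heine_borel \<Rightarrow> 'b::metric_space"
  assumes "continuous_on (closure S) h" "bounded S"
  shows "bounded (h ` S)"
proof -
  have "bounded (h ` closure S)"
    using assms by (simp add: compact_closure compact_continuous_image compact_imp_bounded)
  then show ?thesis by (rule bounded_subset) (intro image_mono closure_subset)
qed

lemma frontier_image_subset:
  fixes h :: "'a::heine_borel \<Rightarrow> 'b::t2_space"
  assumes h: "continuous_on (closure G) h" and G: "bounded G" and op: "open (h ` G)"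
  shows "frontier (h ` G) \<subseteq> h ` frontier G"
proof -
  have "compact (h ` closure G)"
    using G h by (simp add: compact_closure compact_continuous_image)
  then have "closure (h ` G) \<subseteq> h ` closure G"
    by (meson closure_minimal closure_subset compact_imp_closed image_mono)
  then have "frontier (h ` G) \<subseteq> h ` closure G - h ` G"
    using op by (auto simp: frontier_def interior_open)
  also have "\<dots> \<subseteq> h ` frontier G" using interior_subset by (auto simp: frontier_def)
  finally show ?thesis .
qed

lemma compact_subset_image_open:
  fixes f :: "'a::heine_borel \<Rightarrow> 'b::topological_space"
  assumes f: "\<And>S. open S \<Longrightarrow> open (f ` S)" and U: "open U" and K: "compact K" "K \<subseteq> f ` U"
  obtains L where "compact L" "L \<subseteq> U" "K \<subseteq> f ` L"
proof -
  obtain e where e: "\<And>x. x \<in> U \<Longrightarrow> e x > 0" "\<And>x. x \<in> U \<Longrightarrow> cball x (e x) \<subseteq> U"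
    using U unfolding open_contains_cball by metis
  have "x \<in> ball x (e x)" if "x \<in> U" for x using e(1)[OF that] by simp
  then have "K \<subseteq> (\<Union>x\<in>U. f ` ball x (e x))" using K(2) by blast
  then obtain C where C: "C \<subseteq> U" "finite C" "K \<subseteq> (\<Union>x\<in>C. f ` ball x (e x))"
    by (rule compactE_image[OF K(1) f[OF open_ball]])
  show ?thesis
  proof
    show "compact (\<Union>x\<in>C. cball x (e x))" using C(2) by (intro compact_UN) auto
    show "(\<Union>x\<in>C. cball x (e x)) \<subseteq> U" using C(1) e(2) by blast
    show "K \<subseteq> f ` (\<Union>x\<in>C. cball x (e x))"
      unfolding image_UN
      by (rule order_trans[OF C(3)]) (intro UN_mono image_mono ball_subset_cball order_refl)
  qed
qed

lemma connected_meets_sphere: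
  fixes S :: "'a::metric_space set"
  assumes "connected S" "x \<in> S" "y \<in> S" "dist a x \<le> r" "r \<le> dist a y"
  obtains z where "z \<in> S" "dist a z = r"
proof -
  have "connected (dist a ` S)" by (intro connected_continuous_image continuous_intros assms)
  then have "r \<in> dist a ` S" using connectedD_interval assms(2-5) by blast
  then show ?thesis using that by blast
qed

lemma connected_subset_ball:
  fixes S :: "'a::metric_space set"
  assumes "connected S" "a \<in> S" "S \<inter> sphere a r = {}" "0 < r"
  shows "S \<subseteq> ball a r"
proof
  fix x assume x: "x \<in> S"
  show "x \<in> ball a r"
  proof (rule ccontr)
    assume "x \<notin> ball a r"
    then obtain z where "z \<in> S" "dist a z = r"
      using connected_meets_sphere[of S a x a r] assms x by auto
    then show False using assms(3) by auto
  qed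
qed

lemma frontier_connected_component_Diff:
  fixes S :: "'a::real_normed_vector set"
  assumes "open S" "closed K"
  shows "S \<inter> frontier (connected_component_set (S - K) a) \<subseteq> K"
  using frontier_of_connected_component_subset[of "S - K" a] open_Diff[OF assms]
  by (auto simp: frontier_def interior_open)

lemma frontier_nonempty_if_bounded:
  fixes S :: "'a::{real_normed_vector, perfect_space} set"
  assumes "bounded S" "S \<noteq> {}"
  shows "frontier S \<noteq> {}"
  using assms not_bounded_UNIV by (auto simp: frontier_eq_empty)

lemma complement_outside_open:
  fixes A :: "'a::euclidean_space set"
  assumes "open A" "bounded A" "2 \<le> DIM('a)"
  shows "open (- outside A)" "frontier (- outside A) \<subseteq> frontier A"
proof -
  have outside: "outside A \<in> components (- A)"
    using assms by (simp add: outside_in_components connected_outside outside_bounded_nonempty)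
  then show "open (- outside A)" using assms(1) closed_components by blast
  show "frontier (- outside A) \<subseteq> frontier A"
    using frontier_of_components_subset[OF outside] by (simp add: frontier_complement)
qed

section \<open>Blowing up at Julia points\<close>

lemma julia_iterate_surrounds_ball:
  assumes f: "f holomorphic_on UNIV" and G: "open G" "bounded G" "G \<inter> julia_set f \<noteq> {}"
  obtains m where "ball 0 R \<subseteq> - outside ((f ^^ m) ` G)"
proof (rule ccontr)
  assume no_thesis: "\<not> thesis"
  have hole: "\<exists>p. norm p < R \<and> p \<in> outside ((f ^^ n) ` G)" for n
    using no_thesis that[of n] by (auto simp: subset_iff)
  then have "R > 0" using le_less_trans[OF norm_ge_zero] by blast
  obtain z e where z: "z \<in> julia_set f" and e: "e > 0" "ball z e \<subseteq> G"
    using G(1,3) open_contains_ball by blast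
  have "normal_family_on (range (\<lambda>n. f ^^ n)) (ball z e)"
  proof (rule normal_family_on_omitting_bounded_separated_pairs[OF _ _ _ \<open>R > 0\<close>])
    fix h assume "h \<in> range (\<lambda>n. f ^^ n)"
    then obtain n where h: "h = f ^^ n" by blast
    show "h holomorphic_on ball z e" using holomorphic_on_funpow[OF f] h by simp
    obtain p where p: "norm p < R" "p \<in> outside (h ` G)" using hole h by blast
    have bdd: "bounded (h ` G)"
      using bounded_continuous_image G(2) holomorphic_on_funpow[OF f] h
          holomorphic_on_imp_continuous_on
      by blast
    obtain y where "y \<in> outside (h ` G)" "norm y \<ge> 2 * R"
      using unbounded_outside[OF bdd] unfolding bounded_iff by (metis nle_le)
    then obtain q where q: "q \<in> outside (h ` G)" "dist 0 q = 2 * R"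
      using connected_meets_sphere[OF connected_outside[OF bdd], of p y 0 "2 * R"] p \<open>R > 0\<close> by auto
    have "h ` ball z e \<inter> outside (h ` G) = {}"
      using e(2) outside_no_overlap[of "h ` G"] by blast
    then have "p \<notin> h ` ball z e" "q \<notin> h ` ball z e" using p(2) q(1) by blast+
    moreover have "R \<le> norm (q - p)" using norm_triangle_ineq2[of q p] p(1) q(2) by simp
    ultimately show "\<exists>p q. norm p \<le> 2 * R \<and> norm q \<le> 2 * R \<and> R \<le> norm (q - p) \<and>
        p \<notin> h ` ball z e \<and> q \<notin> h ` ball z e"
      using p(1) q(2) \<open>R > 0\<close> by (intro exI[of _ p] exI[of _ q]) simp
  qed auto
  then have "z \<in> fatou_set f" using e(1) unfolding fatou_set_def by force
  then show False using z by (simp add: julia_set_def)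
qed

lemma nonconstant_entire_open_image:
  assumes "f holomorphic_on UNIV" "\<not> f constant_on UNIV" "open S"
  shows "open (f ` S)"
  using open_mapping_thm[of f UNIV S] assms by (simp add: connected_UNIV)

lemma julia_blow_up:
  assumes f: "f holomorphic_on UNIV" "\<not> f constant_on UNIV"
    and G: "open G" "bounded G" "G \<inter> julia_set f \<noteq> {}"
  obtains m D where "open D" "bounded D" "ball 0 R \<subseteq> D" "frontier D \<subseteq> (f ^^ m) ` frontier G"
proof -
  obtain m where m: "ball 0 R \<subseteq> - outside ((f ^^ m) ` G)"
    using julia_iterate_surrounds_ball[OF f(1) G] .
  define A where "A = (f ^^ m) ` G"
  have cont: "continuous_on (closure G) (f ^^ m)"
    using holomorphic_on_funpow[OF f(1)] by (rule holomorphic_on_imp_continuous_on)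
  have A: "open A" "bounded A"
    unfolding A_def using open_funpow_image nonconstant_entire_open_image[OF f] G(1)
    by (blast, intro bounded_continuous_image cont G(2))
  note hull = complement_outside_open[OF A, simplified]
  have "frontier (- outside A) \<subseteq> (f ^^ m) ` frontier G"
    using hull(2) frontier_image_subset[OF cont G(2)] A by (auto simp: A_def)
  then show ?thesis using that hull(1) cobounded_outside[OF A(2)] m by (simp add: A_def)
qed

section \<open>Pulling back through the logarithmic tract\<close>

locale log_tract =
  fixes f :: "complex \<Rightarrow> complex" and \<alpha> :: complex and r :: real and U :: "complex set"
  assumes entire: "f holomorphic_on UNIV"
    and nonconstant: "\<not> f constant_on UNIV"
    and r_pos: "0 < r"
    and tract: "U \<in> components (f -` ball \<alpha> r)"
    and image_tract: "f ` U = ball \<alpha> r - {\<alpha>}"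
    and alpha_in_julia: "\<alpha> \<in> julia_set f"

lemma transcendental_entire_not_constant:
  assumes "transcendental_entire f"
  shows "\<not> f constant_on UNIV"
proof
  assume "f constant_on UNIV"
  then obtain c where "\<And>z. f z = c" unfolding constant_on_def by auto
  then have "\<forall>z. f z = poly [:c:] z" by simp
  then show False using assms unfolding transcendental_entire_def by blast
qed

lemma exists_log_tract:
  assumes "transcendental_entire f" "finite_log_asymptotic_value f \<alpha>" "\<alpha> \<in> julia_set f"
  obtains r U where "log_tract f \<alpha> r U"
proof -
  obtain r U where r: "r > 0" and U: "U \<in> components (f -` ball \<alpha> r)"
    and cov: "covering_space U f (ball \<alpha> r - {\<alpha>})"
    using assms(2) unfolding finite_log_asymptotic_value_def by blast
  have "f ` U = ball \<alpha> r - {\<alpha>}" by (rule covering_space_imp_surjective[OF cov])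
  moreover have "f holomorphic_on UNIV" using assms(1) by (simp add: transcendental_entire_def)
  ultimately show ?thesis
    using that assms(3) r U transcendental_entire_not_constant[OF assms(1)]
    by (simp add: log_tract_def)
qed

context log_tract begin

lemma open_image: "open S \<Longrightarrow> open (f ` S)"
  using nonconstant_entire_open_image entire nonconstant by blast

lemma continuous_f: "continuous_on S f"
  using entire holomorphic_on_imp_continuous_on continuous_on_subset by blast

lemmas continuous_funpow = continuous_on_funpow[OF continuous_f]

lemma open_tract: "open U"
  using open_vimage[OF open_ball continuous_f] tract open_components by blast

lemma mem_tract_if_closure:
  assumes "x \<in> closure U" "f x \<in> ball \<alpha> r"
  shows "x \<in> U"
proof -
  obtain T where T: "closed T" "U = f -` ball \<alpha> r \<inter> T"
    using closedin_component[OF tract] unfolding closedin_closed by blast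
  then have "closure U \<subseteq> T" by (metis closure_minimal inf_le2)
  then show ?thesis using T assms by auto
qed

lemma image_closure_tract_ne: "x \<in> closure U \<Longrightarrow> f x \<noteq> \<alpha>"
  using mem_tract_if_closure image_tract r_pos by fastforce

(* If N - {\<alpha>} meets f (U \<inter> D) then it lies in it, and \<alpha> would be in the compact set
   f (closure U \<inter> closure D). *)
lemma image_tract_Int_disjoint:
  assumes D: "open D" "bounded D"
    and N: "open N" "connected N" "\<alpha> \<in> N" "N \<subseteq> ball \<alpha> r" "N \<inter> f ` (closure U \<inter> frontier D) = {}"
  shows "N \<inter> f ` (U \<inter> D) = {}"
proof -
  define P where "P = N - {\<alpha>}"
  define Q where "Q = f ` (closure U \<inter> closure D)"
  have "compact (closure U \<inter> closure D)"
    using D(2) by (simp add: closed_Int_compact compact_closure)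
  then have Q: "closed Q"
    unfolding Q_def by (intro compact_imp_closed compact_continuous_image continuous_f)
  have P: "open P" "connected P"
    using N(1,2) by (simp_all add: P_def open_delete connected_open_delete)
  have eq: "P \<inter> f ` (U \<inter> D) = P \<inter> Q"
  proof
    show "P \<inter> f ` (U \<inter> D) \<subseteq> P \<inter> Q"
      unfolding Q_def using closure_subset[of U] closure_subset[of D] by blast
    have "x \<in> U \<inter> D" if "x \<in> closure U" "x \<in> closure D" "f x \<in> N" for x
      using that N(4,5) mem_tract_if_closure D(1) by (auto simp: frontier_def interior_open)
    then show "P \<inter> Q \<subseteq> P \<inter> f ` (U \<inter> D)" by (auto simp: P_def Q_def)
  qed
  have "openin (top_of_set P) (P \<inter> f ` (U \<inter> D))"
    using open_image[OF open_Int[OF open_tract D(1)]] by (rule openin_open_Int)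
  moreover have "closedin (top_of_set P) (P \<inter> f ` (U \<inter> D))"
    unfolding eq using Q by (rule closedin_closed_Int)
  ultimately consider "P \<inter> f ` (U \<inter> D) = {}" | "P \<inter> f ` (U \<inter> D) = P"
    using P(2) unfolding connected_clopen by blast
  then show ?thesis
  proof cases
    case 1
    then show ?thesis using image_tract by (auto simp: P_def)
  next
    case 2
    then have "closure P \<subseteq> Q" using eq Q by (intro closure_minimal) auto
    moreover have "\<alpha> islimpt P"
      using N(1,3) interior_limit_point[of \<alpha> N] unfolding P_def islimpt_def
      by (simp add: interior_open) blast
    ultimately have "\<alpha> \<in> Q" by (auto simp: closure_def)
    then show ?thesis using image_closure_tract_ne by (auto simp: Q_def)
  qed
qed

definition tract_pullback :: "real \<Rightarrow> complex set \<Rightarrow> complex set \<Rightarrow> bool" where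
  "tract_pullback R D N \<longleftrightarrow> open D \<and> bounded D \<and> ball 0 R \<subseteq> D \<and>
     open N \<and> \<alpha> \<in> N \<and> N \<subseteq> ball \<alpha> r \<and> frontier N \<subseteq> f ` frontier D"

lemma tract_pullback_target:
  assumes "tract_pullback R D N"
  shows "open N" "bounded N" "N \<inter> julia_set f \<noteq> {}" "frontier N \<noteq> {}" "frontier N \<subseteq> cball \<alpha> r"
proof -
  show N: "open N" "bounded N" "N \<inter> julia_set f \<noteq> {}"
    using assms alpha_in_julia bounded_subset[OF bounded_ball] by (auto simp: tract_pullback_def)
  then show "frontier N \<noteq> {}" by (intro frontier_nonempty_if_bounded) auto
  have "N \<subseteq> cball \<alpha> r" using assms ball_subset_cball by (auto simp: tract_pullback_def)
  then show "frontier N \<subseteq> cball \<alpha> r" using closure_minimal[of N] by (auto simp: frontier_def)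
qed

lemma exists_tract_pullback:
  "\<exists>S. \<forall>D. open D \<and> bounded D \<and> ball 0 R \<subseteq> D \<and> ball 0 S \<subseteq> D \<longrightarrow> (\<exists>N. tract_pullback R D N)"
proof -
  have "sphere \<alpha> (r/2) \<subseteq> f ` U" using r_pos by (auto simp: image_tract)
  then obtain L where L: "compact L" "L \<subseteq> U" "sphere \<alpha> (r/2) \<subseteq> f ` L"
    using compact_subset_image_open[OF open_image open_tract compact_sphere] by metis
  obtain S where S: "L \<subseteq> ball 0 S" using compact_imp_bounded[OF L(1)] bounded_subset_ballD by blast
  have "\<exists>N. tract_pullback R D N" if D: "open D" "bounded D" "ball 0 R \<subseteq> D" "ball 0 S \<subseteq> D" for D
  proof -
    define K where "K = f ` (closure U \<inter> frontier D)"
    have "compact (closure U \<inter> frontier D)"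
      using D(2) by (simp add: closed_Int_compact compact_frontier_bounded)
    then have K: "closed K"
      unfolding K_def by (intro compact_imp_closed compact_continuous_image continuous_f)
    define N where "N = connected_component_set (ball \<alpha> r - K) \<alpha>"
    have "\<alpha> \<notin> K" using image_closure_tract_ne by (auto simp: K_def)
    then have N: "open N" "connected N" "\<alpha> \<in> N" "N \<subseteq> ball \<alpha> r - K"
      using K r_pos unfolding N_def
      by (auto simp: open_connected_component open_Diff connected_component_refl_eq
          connected_component_subset)
    have "N \<inter> f ` (U \<inter> D) = {}"
      by (rule image_tract_Int_disjoint[OF D(1,2) N(1-3)]) (use N(4) in \<open>auto simp: K_def\<close>)
    then have "N \<inter> sphere \<alpha> (r/2) = {}" using L(2,3) S D(4) by blast
    then have "N \<subseteq> ball \<alpha> (r/2)" using connected_subset_ball N(2,3) r_pos by (metis half_gt_zero)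
    then have "closure N \<subseteq> cball \<alpha> (r/2)" using ball_subset_cball by (intro closure_minimal) auto
    then have "frontier N \<subseteq> ball \<alpha> r" using r_pos by (force simp: frontier_def)
    then have "frontier N \<subseteq> K"
      using frontier_connected_component_Diff[OF open_ball K] unfolding N_def by blast
    then have "tract_pullback R D N" using D N by (auto simp: tract_pullback_def K_def)
    then show ?thesis ..
  qed
  then show ?thesis by blast
qed

lemma julia_blow_up_tract_pullback:
  assumes G: "open G" "bounded G" "G \<inter> julia_set f \<noteq> {}"
  obtains m D N where "tract_pullback R D N" "frontier D \<subseteq> (f ^^ m) ` frontier G"
proof -
  obtain S where S: "\<forall>D. open D \<and> bounded D \<and> ball 0 R \<subseteq> D \<and> ball 0 S \<subseteq> D \<longrightarrow>
      (\<exists>N. tract_pullback R D N)"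
    using exists_tract_pullback by blast
  obtain m D where D: "open D" "bounded D" "ball 0 (max R S) \<subseteq> D"
      "frontier D \<subseteq> (f ^^ m) ` frontier G"
    by (rule julia_blow_up[OF entire nonconstant G])
  then have "ball 0 R \<subseteq> D" "ball 0 S \<subseteq> D" by (auto simp: subset_iff)
  then obtain N where "tract_pullback R D N" using S D(1,2) by blast
  then show ?thesis using D(4) by (rule that)
qed

lemma tract_pullback_tower:
  assumes G: "open G" "bounded G" "G \<inter> julia_set f \<noteq> {}"
  obtains l m D N where "frontier (D 0) \<subseteq> (f ^^ l) ` frontier G"
    "\<And>n. tract_pullback (real n) (D n) (N n)"
    "\<And>n. frontier (D (Suc n)) \<subseteq> (f ^^ m n) ` frontier (N n)"
proof -
  have "\<exists>F. \<forall>n. (tract_pullback (real n) (fst (F n)) (snd (F n)) \<and>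
        (n = 0 \<longrightarrow> (\<exists>l. frontier (fst (F n)) \<subseteq> (f ^^ l) ` frontier G))) \<and>
      (\<exists>m. frontier (fst (F (Suc n))) \<subseteq> (f ^^ m) ` frontier (snd (F n)))"
  proof (rule dependent_nat_choice)
    show "\<exists>x. tract_pullback (real 0) (fst x) (snd x) \<and>
        (0 = (0::nat) \<longrightarrow> (\<exists>l. frontier (fst x) \<subseteq> (f ^^ l) ` frontier G))"
      using julia_blow_up_tract_pullback[OF G, of "real 0"] by (metis fst_conv snd_conv)
  next
    fix x n
    assume "tract_pullback (real n) (fst x) (snd x) \<and>
        (n = 0 \<longrightarrow> (\<exists>l. frontier (fst x) \<subseteq> (f ^^ l) ` frontier G))"
    then obtain m D N where "tract_pullback (real (Suc n)) D N"
        "frontier D \<subseteq> (f ^^ m) ` frontier (snd x)"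
      using julia_blow_up_tract_pullback tract_pullback_target(1-3) by metis
    then show "\<exists>y. (tract_pullback (real (Suc n)) (fst y) (snd y) \<and>
        (Suc n = 0 \<longrightarrow> (\<exists>l. frontier (fst y) \<subseteq> (f ^^ l) ` frontier G))) \<and>
        (\<exists>m. frontier (fst y) \<subseteq> (f ^^ m) ` frontier (snd x))"
      by (intro exI[of _ "(D, N)"]) auto
  qed
  then obtain F where F: "\<And>n. tract_pullback (real n) (fst (F n)) (snd (F n))"
      "\<exists>l. frontier (fst (F 0)) \<subseteq> (f ^^ l) ` frontier G"
      "\<And>n. \<exists>m. frontier (fst (F (Suc n))) \<subseteq> (f ^^ m) ` frontier (snd (F n))"
    by blast
  then show ?thesis using that[of "\<lambda>n. fst (F n)" _ "\<lambda>n. snd (F n)"] by metis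
qed

lemma tract_pullback_itinerary:
  assumes tower: "\<And>n. tract_pullback (real n) (D n) (N n)"
    and step: "\<And>n. frontier (D (Suc n)) \<subseteq> (f ^^ m n) ` frontier (N n)"
  obtains z s where "z \<in> frontier (D 0)" "\<And>n. n \<le> s n"
    "\<And>n. (f ^^ s n) z \<in> frontier (D n)" "\<And>n. (f ^^ Suc (s n)) z \<in> frontier (N n)"
proof -
  define E where "E n = frontier (D n) \<inter> f -` frontier (N n)" for n
  have image_E: "f ` E n = frontier (N n)" for n
    using tower[of n] by (auto simp: E_def tract_pullback_def)
  have "compact (E n)" for n
    unfolding E_def using tower[of n]
    by (intro compact_Int_closed compact_frontier_bounded closed_vimage continuous_f
        frontier_closed)
       (simp add: tract_pullback_def)
  moreover have "E n \<noteq> {}" for n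
    using image_E[of n] tract_pullback_target(4)[OF tower[of n]] by blast
  moreover have "E (Suc n) \<subseteq> (f ^^ Suc (m n)) ` E n" for n
  proof -
    have "(f ^^ Suc (m n)) ` E n = (f ^^ m n) ` frontier (N n)"
      unfolding image_E[symmetric] image_image funpow_swap1[symmetric] by simp
    then show ?thesis using step[of n] by (auto simp: E_def)
  qed
  ultimately obtain z where z: "\<And>n. (f ^^ (\<Sum>j<n. Suc (m j))) z \<in> E n"
    using funpow_itinerary[OF continuous_f] by metis
  have "n \<le> (\<Sum>j<n. Suc (m j))" for n by (induction n) auto
  then show ?thesis using that[of z "\<lambda>n. \<Sum>j<n. Suc (m j)"] z z[of 0] by (simp add: E_def)
qed

lemma julia_frontier_meets_bungee:
  assumes G: "open G" "bounded G" "G \<inter> julia_set f \<noteq> {}"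
  shows "frontier G \<inter> bungee_set f \<noteq> {}"
proof -
  obtain l m D N where start: "frontier (D 0) \<subseteq> (f ^^ l) ` frontier G"
    and tower: "\<And>n. tract_pullback (real n) (D n) (N n)"
    and step: "\<And>n. frontier (D (Suc n)) \<subseteq> (f ^^ m n) ` frontier (N n)"
    using tract_pullback_tower[OF G] by metis
  obtain z s where z: "z \<in> frontier (D 0)" and s: "\<And>n. n \<le> s n"
    and in_D: "\<And>n. (f ^^ s n) z \<in> frontier (D n)"
    and in_N: "\<And>n. (f ^^ Suc (s n)) z \<in> frontier (N n)"
    by (rule tract_pullback_itinerary[OF tower step]) blast
  have "z \<in> bungee_set f"
  proof (rule bungee_setI)
    fix n
    have "(f ^^ Suc (s n)) z \<in> cball \<alpha> r" using in_N tract_pullback_target(5)[OF tower] by blast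
    then have "norm ((f ^^ Suc (s n)) z) \<le> norm \<alpha> + r" by (rule norm_le_if_mem_cball)
    then show "\<exists>k\<ge>n. norm ((f ^^ k) z) \<le> norm \<alpha> + r"
      using s[of n] by (intro exI[of _ "Suc (s n)"]) simp
    have "(f ^^ s n) z \<notin> ball 0 (real n)"
      using in_D[of n] tower[of n] by (auto simp: tract_pullback_def frontier_def interior_open)
    then show "\<exists>k. real n \<le> norm ((f ^^ k) z)" by (intro exI[of _ "s n"]) simp
  qed
  moreover obtain x where "x \<in> frontier G" "z = (f ^^ l) x" using start z by blast
  ultimately show ?thesis using funpow_in_bungee_set_iff by blast
qed

end

section \<open>The Fatou set\<close>

lemma fatou_set_eq_Union: "fatou_set f = \<Union>{V. open V \<and> normal_family_on (range (\<lambda>n. f ^^ n)) V}"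
  by (auto simp: fatou_set_def)

lemma open_fatou_set: "open (fatou_set f)"
  unfolding fatou_set_eq_Union by auto

lemma spherically_convergent_on_compose:
  assumes g: "spherically_convergent_on V g" and f: "continuous_on U f" "f ` U \<subseteq> V"
  shows "spherically_convergent_on U (\<lambda>n z. g n (f z))"
proof -
  have K: "f ` K \<subseteq> V" "compact (f ` K)" if "K \<subseteq> U" "compact K" for K
    using that f compact_continuous_image continuous_on_subset by blast+
  from g show ?thesis
  proof (cases rule: spherically_convergent_onE)
    case (converges h)
    have "uniform_limit K (\<lambda>n z. g n (f z)) (\<lambda>z. h (f z)) sequentially" if "K \<subseteq> U" "compact K" for K
      using converges_compactly_onD[OF converges K[OF that]] by (simp add: uniform_limit_iff)
    then show ?thesis unfolding spherically_convergent_on_def converges_compactly_on_def by blast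
  next
    case escapes
    have "\<forall>\<^sub>F n in sequentially. \<forall>z\<in>K. B \<le> norm (g n (f z))" if "K \<subseteq> U" "compact K" for K B
      using escapes_compactly_onD[OF escapes K[OF that]] by simp
    then show ?thesis unfolding spherically_convergent_on_def escapes_compactly_on_def by blast
  qed
qed

lemma spherically_convergent_on_image:
  fixes f :: "'a::heine_borel \<Rightarrow> 'b::topological_space"
  assumes f: "\<And>S. open S \<Longrightarrow> open (f ` S)" and U: "open U"
    and g: "spherically_convergent_on U (\<lambda>n z. g n (f z))"
  shows "spherically_convergent_on (f ` U) g"
proof -
  have lift: "\<exists>L. compact L \<and> L \<subseteq> U \<and> K \<subseteq> f ` L" if "K \<subseteq> f ` U \<and> compact K" for K
    using compact_subset_image_open[OF f U] that by metis
  from g show ?thesis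
  proof (cases rule: spherically_convergent_onE)
    case (converges h)
    define k where "k w = h (inv_into U f w)" for w
    have lim: "(\<lambda>n. g n (f z)) \<longlonglongrightarrow> h z" if "z \<in> U" for z
      using converges_compactly_onD[OF converges, of "{z}"] that by simp
    have k_f: "k (f z) = h z" if "z \<in> U" for z
    proof -
      have "inv_into U f (f z) \<in> U" "f (inv_into U f (f z)) = f z"
        using that by (auto intro: inv_into_into f_inv_into_f)
      then show ?thesis
        using lim[of z] lim[of "inv_into U f (f z)"] that LIMSEQ_unique by (simp add: k_def)
    qed
    have "uniform_limit K g k sequentially" if K: "K \<subseteq> f ` U \<and> compact K" for K
    proof -
      obtain L where L: "compact L" "L \<subseteq> U" "K \<subseteq> f ` L" using lift[OF K] by blast
      have "uniform_limit (f ` L) g k sequentially"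
        using converges_compactly_onD[OF converges L(2,1)] k_f L(2)
        by (auto simp: uniform_limit_iff subset_iff)
      then show ?thesis using L(3) by (rule uniform_limit_on_subset)
    qed
    then show ?thesis unfolding spherically_convergent_on_def converges_compactly_on_def by blast
  next
    case escapes
    have "\<forall>\<^sub>F n in sequentially. \<forall>w\<in>K. B \<le> norm (g n w)" if K: "K \<subseteq> f ` U \<and> compact K" for K B
    proof -
      obtain L where L: "compact L" "L \<subseteq> U" "K \<subseteq> f ` L" using lift[OF K] by blast
      from escapes_compactly_onD[OF escapes L(2,1)] show ?thesis
        by eventually_elim (use L(3) in blast)
    qed
    then show ?thesis unfolding spherically_convergent_on_def escapes_compactly_on_def by blast
  qed
qed

lemma normal_iterates_image:
  assumes f: "\<And>S. open S \<Longrightarrow> open (f ` S)" and U: "open U" "normal_family_on (range (\<lambda>n. f ^^ n)) U"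
  shows "normal_family_on (range (\<lambda>n. f ^^ n)) (f ` U)"
  unfolding normal_family_on_iff
proof (intro allI impI)
  fix g :: "nat \<Rightarrow> complex \<Rightarrow> complex" assume "range g \<subseteq> range (\<lambda>n. f ^^ n)"
  then have "\<forall>j. \<exists>n. g j = f ^^ n" by blast
  then obtain n where n: "\<And>j. g j = f ^^ n j" by metis
  then have shift: "g j (f z) = (f ^^ Suc (n j)) z" for j z by (simp add: funpow_swap1)
  have "range (\<lambda>j. f ^^ Suc (n j)) \<subseteq> range (\<lambda>n. f ^^ n)" by blast
  then obtain r where "strict_mono r" "spherically_convergent_on U (\<lambda>j. f ^^ Suc (n (r j)))"
    using U(2) unfolding normal_family_on_iff by blast
  moreover from this(2) have "spherically_convergent_on (f ` U) (\<lambda>j. g (r j))"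
    by (intro spherically_convergent_on_image[OF f U(1)]) (simp_all only: shift eta_contract_eq)
  ultimately show "\<exists>r. strict_mono r \<and> spherically_convergent_on (f ` U) (\<lambda>j. g (r j))" by blast
qed

lemma normal_iterates_vimage:
  assumes f: "continuous_on UNIV f" and V: "normal_family_on (range (\<lambda>n. f ^^ n)) V"
  shows "normal_family_on (range (\<lambda>n. f ^^ n)) (f -` V)"
  unfolding normal_family_on_iff
proof (intro allI impI)
  fix g :: "nat \<Rightarrow> complex \<Rightarrow> complex" assume "range g \<subseteq> range (\<lambda>n. f ^^ n)"
  then have "\<forall>j. \<exists>n. g j = f ^^ n" by blast
  then obtain n where n: "\<And>j. g j = f ^^ n j" by metis
  have "{j. n j = 0} \<union> {j. n j > 0} = UNIV" by auto
  then consider "infinite {j. n j = 0}" | "infinite {j. n j > 0}"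
    by (metis finite_Un infinite_UNIV_nat)
  then show "\<exists>r. strict_mono r \<and> spherically_convergent_on (f -` V) (\<lambda>j. g (r j))"
  proof cases
    case 1
    then obtain r :: "nat \<Rightarrow> nat" where r: "strict_mono r" "\<And>j. n (r j) = 0"
      using infinite_enumerate by blast
    have "converges_compactly_on (f -` V) (\<lambda>j. g (r j)) id"
      unfolding converges_compactly_on_def n r(2) by (simp add: uniform_limit_const)
    then show ?thesis using r(1) unfolding spherically_convergent_on_def by blast
  next
    case 2
    then obtain s :: "nat \<Rightarrow> nat" where s: "strict_mono s" "\<And>j. n (s j) > 0"
      using infinite_enumerate by blast
    have "range (\<lambda>j. f ^^ (n (s j) - 1)) \<subseteq> range (\<lambda>n. f ^^ n)" by blast
    then obtain r where r: "strict_mono r"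
        "spherically_convergent_on V (\<lambda>j. f ^^ (n (s (r j)) - 1))"
      using V unfolding normal_family_on_iff by blast
    have "(f ^^ (n (s j) - 1)) (f z) = g (s j) z" for j z
      using s(2)[of j] by (cases "n (s j)") (simp_all add: n funpow_swap1)
    then have "spherically_convergent_on (f -` V) (\<lambda>j. g (s (r j)))"
      using spherically_convergent_on_compose[OF r(2) continuous_on_subset[OF f subset_UNIV]]
      by simp
    then show ?thesis using strict_mono_o[OF s(1) r(1)] by (intro exI[of _ "s \<circ> r"]) simp
  qed
qed

lemma image_in_fatou_set_iff:
  assumes f: "continuous_on UNIV f" "\<And>S. open S \<Longrightarrow> open (f ` S)"
  shows "f z \<in> fatou_set f \<longleftrightarrow> z \<in> fatou_set f"
proof
  assume "z \<in> fatou_set f"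
  then obtain U where "open U" "z \<in> U" "normal_family_on (range (\<lambda>n. f ^^ n)) U"
    unfolding fatou_set_def by blast
  then show "f z \<in> fatou_set f"
    using f(2) normal_iterates_image[OF f(2), of U] unfolding fatou_set_def by blast
next
  assume "f z \<in> fatou_set f"
  then obtain V where "open V" "f z \<in> V" "normal_family_on (range (\<lambda>n. f ^^ n)) V"
    unfolding fatou_set_def by blast
  then show "z \<in> fatou_set f"
    using open_vimage[OF _ f(1), of V] normal_iterates_vimage[OF f(1), of V]
    unfolding fatou_set_def by blast
qed

lemma funpow_in_fatou_set_iff:
  assumes "continuous_on UNIV f" "\<And>S. open S \<Longrightarrow> open (f ` S)"
  shows "(f ^^ n) z \<in> fatou_set f \<longleftrightarrow> z \<in> fatou_set f"
  by (induction n) (simp_all add: image_in_fatou_set_iff assms)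

section \<open>Continua in the Fatou set\<close>

lemma compact_subset_incseq_open:
  assumes "compact C" "\<And>n::nat. open (W n)" "incseq W" "C \<subseteq> (\<Union>n. W n)"
  obtains n where "C \<subseteq> W n"
proof -
  obtain I where I: "finite I" "C \<subseteq> (\<Union>n\<in>I. W n)"
    using compactE_image[of C UNIV W] assms(1,2,4) by metis
  obtain N where "I \<subseteq> {..N}" using I(1) finite_nat_iff_bounded_le by auto
  then have "W n \<subseteq> W N" if "n \<in> I" for n using incseqD[OF assms(3)] that by blast
  then have "C \<subseteq> W N" using I(2) by blast
  then show ?thesis by (rule that)
qed

definition local_bound_domain ::
    "(nat \<Rightarrow> 'a::topological_space \<Rightarrow> 'b::real_normed_vector) \<Rightarrow> 'a set" where
  "local_bound_domain g = (\<Union>k. interior {z. \<forall>n\<ge>k. norm (g n z) \<le> real k})"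

lemma open_local_bound_domain: "open (local_bound_domain g)"
  by (auto simp: local_bound_domain_def)

lemma bounded_on_compact_subset_local_bound_domain:
  assumes "compact C" "C \<subseteq> local_bound_domain g"
  shows "\<exists>B. \<forall>\<^sub>F n in sequentially. \<forall>z\<in>C. norm (g n z) \<le> B"
proof -
  define A where "A k = interior {z. \<forall>n\<ge>k. norm (g n z) \<le> real k}" for k
  have "incseq A"
    unfolding A_def incseq_def
    by (intro allI impI interior_mono Collect_mono) (meson of_nat_le_iff order_trans)
  then obtain k where "C \<subseteq> A k"
    using compact_subset_incseq_open[OF assms(1), of A] assms(2)
    unfolding A_def local_bound_domain_def by blast
  then have "\<forall>z\<in>C. norm (g n z) \<le> real k" if "n \<ge> k" for n
    using that interior_subset unfolding A_def by blast
  then show ?thesis unfolding eventually_sequentially by blast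
qed

lemma converges_compactly_on_subset_local_bound_domain:
  fixes g :: "nat \<Rightarrow> 'a::heine_borel \<Rightarrow> 'b::real_normed_vector"
  assumes V: "open V" and conv: "converges_compactly_on V g h" "\<And>n. continuous_on V (g n)"
  shows "V \<subseteq> local_bound_domain g"
proof
  fix x assume "x \<in> V"
  then obtain e where e: "e > 0" "cball x e \<subseteq> V" using V open_contains_cball by blast
  have "continuous_on (cball x e) h"
    by (rule converges_compactly_on_continuous_limit[OF conv e(2) compact_cball])
  then have "bounded (h ` cball x e)"
    using compact_cball compact_continuous_image compact_imp_bounded by blast
  then obtain B where B: "\<And>z. z \<in> cball x e \<Longrightarrow> norm (h z) \<le> B" unfolding bounded_iff by blast
  have "\<forall>\<^sub>F n in sequentially. \<forall>z\<in>cball x e. dist (g n z) (h z) < 1"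
    by (rule uniform_limitD[OF converges_compactly_onD[OF conv(1) e(2) compact_cball]]) simp
  then obtain N where N: "\<And>n z. n \<ge> N \<Longrightarrow> z \<in> cball x e \<Longrightarrow> dist (g n z) (h z) < 1"
    unfolding eventually_sequentially by blast
  obtain M where M: "B + 1 \<le> real M" using real_arch_simple by blast
  have "norm (g n z) \<le> real (max N M)" if "n \<ge> N" "z \<in> cball x e" for n z
    using B[OF that(2)] N[OF that] norm_triangle_ineq2[of "g n z" "h z"] M by (simp add: dist_norm)
  then have "ball x e \<subseteq> {z. \<forall>n\<ge>max N M. norm (g n z) \<le> real (max N M)}" by auto
  then have "x \<in> interior {z. \<forall>n\<ge>max N M. norm (g n z) \<le> real (max N M)}"
    using e(1) by (intro interiorI) auto
  then show "x \<in> local_bound_domain g" unfolding local_bound_domain_def by blast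
qed

lemma escapes_compactly_on_Union:
  fixes g :: "nat \<Rightarrow> 'a::heine_borel \<Rightarrow> 'b::real_normed_vector"
  assumes V: "\<And>V. V \<in> \<V> \<Longrightarrow> open V \<and> escapes_compactly_on V g"
  shows "escapes_compactly_on (\<Union>\<V>) g"
  unfolding escapes_compactly_on_def
proof (intro allI impI)
  fix C and B :: real assume C: "C \<subseteq> \<Union>\<V> \<and> compact C"
  define W where "W k = interior {z. \<forall>n\<ge>k. B \<le> norm (g n z)}" for k
  have "C \<subseteq> (\<Union>k. W k)"
  proof
    fix z assume "z \<in> C"
    then obtain V where V: "open V" "z \<in> V" "escapes_compactly_on V g" using C assms by blast
    obtain e where e: "e > 0" "cball z e \<subseteq> V" using V open_contains_cball by blast
    obtain k where "\<And>n. n \<ge> k \<Longrightarrow> \<forall>z\<in>cball z e. B \<le> norm (g n z)"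
      using escapes_compactly_onD[OF V(3) e(2) compact_cball]
      unfolding eventually_sequentially by metis
    then have "ball z e \<subseteq> {z. \<forall>n\<ge>k. B \<le> norm (g n z)}" by auto
    then have "z \<in> W k" unfolding W_def using e(1) by (intro interiorI) auto
    then show "z \<in> (\<Union>k. W k)" by blast
  qed
  moreover have "incseq W" unfolding W_def incseq_def by (intro allI impI interior_mono) force
  ultimately obtain k where "C \<subseteq> W k"
    using C compact_subset_incseq_open[of C W] unfolding W_def by blast
  then have "\<forall>z\<in>C. B \<le> norm (g n z)" if "n \<ge> k" for n
    using that interior_subset unfolding W_def by blast
  then show "\<forall>\<^sub>F n in sequentially. \<forall>z\<in>C. B \<le> norm (g n z)"
    unfolding eventually_sequentially by blast
qed

lemma local_bound_domain_Int_escapes_compactly_on: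
  assumes "escapes_compactly_on E g"
  shows "local_bound_domain g \<inter> E = {}"
proof -
  have False if z: "z \<in> local_bound_domain g" "z \<in> E" for z
  proof -
    obtain k where k: "z \<in> interior {z. \<forall>n\<ge>k. norm (g n z) \<le> real k}"
      using z(1) unfolding local_bound_domain_def by blast
    have "\<forall>\<^sub>F n in sequentially. \<forall>z\<in>{z}. real k + 1 \<le> norm (g n z)"
      using z(2) by (intro escapes_compactly_onD[OF assms]) auto
    then obtain N where "\<forall>n\<ge>N. real k + 1 \<le> norm (g n z)" by (auto simp: eventually_sequentially)
    then have "real k + 1 \<le> norm (g (max N k) z)" by simp
    moreover have "norm (g (max N k) z) \<le> real k"
      using subsetD[OF interior_subset k] by simp
    ultimately show False by simp
  qed
  then show ?thesis by blast
qed

lemma spherically_convergent_on_continuum: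
  fixes g :: "nat \<Rightarrow> 'a::heine_borel \<Rightarrow> 'b::real_normed_vector"
  assumes C: "compact C" "connected C" and g: "\<And>n. continuous_on UNIV (g n)"
    and local: "\<And>z. z \<in> C \<Longrightarrow> \<exists>V. open V \<and> z \<in> V \<and> spherically_convergent_on V g"
  shows "(\<exists>B. \<forall>\<^sub>F n in sequentially. \<forall>z\<in>C. norm (g n z) \<le> B) \<or>
    (\<forall>B. \<forall>\<^sub>F n in sequentially. \<forall>z\<in>C. B \<le> norm (g n z))"
proof -
  define E where "E = \<Union>{V. open V \<and> escapes_compactly_on V g}"
  have E: "escapes_compactly_on E g" unfolding E_def by (rule escapes_compactly_on_Union) blast
  have cover: "C \<subseteq> local_bound_domain g \<union> E"
  proof
    fix z assume "z \<in> C"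
    then obtain V where V: "open V" "z \<in> V" "spherically_convergent_on V g" using local by blast
    from V(3) show "z \<in> local_bound_domain g \<union> E"
    proof (cases rule: spherically_convergent_onE)
      case (converges h)
      then have "V \<subseteq> local_bound_domain g"
        using continuous_on_subset[OF g subset_UNIV]
        by (rule converges_compactly_on_subset_local_bound_domain[OF V(1)])
      then show ?thesis using V(2) by blast
    next
      case escapes
      then show ?thesis using V(1,2) unfolding E_def by blast
    qed
  qed
  have "local_bound_domain g \<inter> E = {}" by (rule local_bound_domain_Int_escapes_compactly_on[OF E])
  then have "local_bound_domain g \<inter> C = {} \<or> E \<inter> C = {}"
    using cover by (intro connectedD[OF C(2)] open_local_bound_domain) (auto simp: E_def)
  then consider "C \<subseteq> local_bound_domain g" | "C \<subseteq> E" using cover by blast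
  then show ?thesis
  proof cases
    case 1
    then show ?thesis using bounded_on_compact_subset_local_bound_domain[OF C(1)] by blast
  next
    case 2
    then show ?thesis using escapes_compactly_onD[OF E _ C(1)] by blast
  qed
qed

lemma normal_family_on_finite_subsequence:
  fixes g :: "nat \<Rightarrow> complex \<Rightarrow> complex"
  assumes "finite \<V>" "\<And>V. V \<in> \<V> \<Longrightarrow> normal_family_on F V" "range g \<subseteq> F"
  obtains r where "strict_mono r" "\<And>V. V \<in> \<V> \<Longrightarrow> spherically_convergent_on V (\<lambda>n. g (r n))"
proof -
  have "\<exists>r. strict_mono r \<and> (\<forall>V\<in>\<V>. spherically_convergent_on V (\<lambda>n. g (r n)))"
    using assms(1,2)
  proof (induction \<V> rule: finite_induct)
    case empty
    then show ?case using strict_mono_id by blast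
  next
    case (insert V \<V>)
    then obtain r where r: "strict_mono r" "\<And>W. W \<in> \<V> \<Longrightarrow> spherically_convergent_on W (\<lambda>n. g (r n))"
      by blast
    have "range (\<lambda>n. g (r n)) \<subseteq> F" using assms(3) by blast
    then obtain s where s: "strict_mono s" "spherically_convergent_on V (\<lambda>n. g (r (s n)))"
      using insert.prems[of V] unfolding normal_family_on_iff by blast
    have "spherically_convergent_on W (\<lambda>n. g (r (s n)))" if "W \<in> \<V>" for W
      using spherically_convergent_on_subseq[OF r(2)[OF that] s(1)] .
    moreover have "strict_mono (\<lambda>n. r (s n))" using strict_mono_o[OF r(1) s(1)] by (simp add: o_def)
    ultimately show ?case using s(2) by (intro exI[of _ "\<lambda>n. r (s n)"]) auto
  qed
  then show ?thesis using that by blast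
qed

lemma frequently_if_eventually_subseq:
  assumes "strict_mono (r :: nat \<Rightarrow> nat)" "\<forall>\<^sub>F j in sequentially. P (r j)"
  shows "\<exists>\<^sub>F n in sequentially. P n"
  unfolding frequently_sequentially
proof
  fix N
  obtain M where "\<And>j. j \<ge> M \<Longrightarrow> P (r j)" using assms(2) unfolding eventually_sequentially by blast
  then have "P (r (max M N))" by simp
  moreover have "N \<le> r (max M N)" using seq_suble[OF assms(1), of "max M N"] by simp
  ultimately show "\<exists>n\<ge>N. P n" by blast
qed

(* Normality only gives a dichotomy near each point of C; connectedness forces the same
   alternative everywhere on C. *)
lemma bounded_iterates_on_fatou_continuum:
  assumes f: "f holomorphic_on UNIV" and C: "compact C" "connected C" "C \<subseteq> fatou_set f"
    and near: "\<And>j. \<exists>z\<in>C. norm ((f ^^ n j) z) \<le> B"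
  obtains K where "\<exists>\<^sub>F j in sequentially. \<forall>z\<in>C. norm ((f ^^ n j) z) \<le> K"
proof -
  obtain \<V> where \<V>: "finite \<V>" "C \<subseteq> \<Union>\<V>"
      "\<V> \<subseteq> {V. open V \<and> normal_family_on (range (\<lambda>n. f ^^ n)) V}"
    by (rule compactE[OF C(1) C(3)[unfolded fatou_set_eq_Union]]) auto
  obtain r where r: "strict_mono r"
    and sph: "\<And>V. V \<in> \<V> \<Longrightarrow> spherically_convergent_on V (\<lambda>j. f ^^ n (r j))"
    by (rule normal_family_on_finite_subsequence[OF \<V>(1), of "range (\<lambda>n. f ^^ n)" "\<lambda>j. f ^^ n j"])
       (use \<V>(3) in auto)
  have "(\<exists>K. \<forall>\<^sub>F j in sequentially. \<forall>z\<in>C. norm ((f ^^ n (r j)) z) \<le> K) \<or>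
      (\<forall>K. \<forall>\<^sub>F j in sequentially. \<forall>z\<in>C. K \<le> norm ((f ^^ n (r j)) z))"
  proof (rule spherically_convergent_on_continuum[OF C(1,2)])
    show "continuous_on UNIV (f ^^ n (r j))" for j
      by (rule holomorphic_on_imp_continuous_on[OF holomorphic_on_funpow[OF f]])
    show "\<exists>V. open V \<and> z \<in> V \<and> spherically_convergent_on V (\<lambda>j. f ^^ n (r j))" if z: "z \<in> C" for z
    proof -
      obtain V where V: "V \<in> \<V>" "z \<in> V" using z \<V>(2) by blast
      then have "open V" using \<V>(3) by blast
      then show ?thesis using V(2) sph[OF V(1)] by blast
    qed
  qed
  then show ?thesis
  proof
    assume "\<exists>K. \<forall>\<^sub>F j in sequentially. \<forall>z\<in>C. norm ((f ^^ n (r j)) z) \<le> K"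
    then obtain K where "\<forall>\<^sub>F j in sequentially. \<forall>z\<in>C. norm ((f ^^ n (r j)) z) \<le> K" ..
    from frequently_if_eventually_subseq[OF r this] show ?thesis by (rule that)
  next
    assume "\<forall>K. \<forall>\<^sub>F j in sequentially. \<forall>z\<in>C. K \<le> norm ((f ^^ n (r j)) z)"
    then have "\<forall>\<^sub>F j in sequentially. \<forall>z\<in>C. B + 1 \<le> norm ((f ^^ n (r j)) z)" by blast
    then obtain j where "\<forall>z\<in>C. B + 1 \<le> norm ((f ^^ n (r j)) z)"
      using eventually_happens'[OF sequentially_bot] by blast
    then show ?thesis using near[of "r j"] by force
  qed
qed

lemma bounded_iterates_on_fatou_domain:
  assumes f: "f holomorphic_on UNIV" and G: "open G" "connected G" "G \<subseteq> fatou_set f"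
    and xy: "x \<in> G" "y \<in> G" and bdd: "\<And>j. norm ((f ^^ s j) x) \<le> B"
  obtains K where "\<exists>\<^sub>F j in sequentially. norm ((f ^^ s j) y) \<le> K"
proof -
  obtain p where p: "path p" "path_image p \<subseteq> G" "pathstart p = x" "pathfinish p = y"
    using connected_open_path_connected[OF G(1,2)] xy unfolding path_connected_def by blast
  have ends: "x \<in> path_image p" "y \<in> path_image p"
    using pathstart_in_path_image[of p] pathfinish_in_path_image[of p] p(3,4) by auto
  then have near: "\<exists>z\<in>path_image p. norm ((f ^^ s j) z) \<le> B" for j using bdd by blast
  obtain K where "\<exists>\<^sub>F j in sequentially. \<forall>z\<in>path_image p. norm ((f ^^ s j) z) \<le> K"
    by (rule bounded_iterates_on_fatou_continuum[OF f compact_path_image[OF p(1)]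
          connected_path_image[OF p(1)] order_trans[OF p(2) G(3)] near])
  then have "\<exists>\<^sub>F j in sequentially. norm ((f ^^ s j) y) \<le> K"
    using ends(2) by (blast intro: frequently_mono[rotated])
  then show ?thesis by (rule that)
qed

lemma fatou_domain_subset_bungee:
  assumes f: "f holomorphic_on UNIV" and G: "open G" "connected G" "G \<subseteq> fatou_set f"
    and x: "x \<in> G" "x \<in> bungee_set f"
  shows "G \<subseteq> bungee_set f"
proof
  fix y assume y: "y \<in> G"
  note transfer = bounded_iterates_on_fatou_domain[OF f G]
  obtain K where "\<exists>\<^sub>F n in sequentially. norm ((f ^^ n) x) < K"
    using x(2) unfolding bungee_set_iff by blast
  then have "infinite {n. norm ((f ^^ n) x) < K}"
    by (simp flip: cofinite_eq_sequentially frequently_cofinite)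
  then obtain s where s: "strict_mono (s :: nat \<Rightarrow> nat)" "\<And>j. norm ((f ^^ s j) x) < K"
    using infinite_enumerate by blast
  obtain K' where K': "\<exists>\<^sub>F j in sequentially. norm ((f ^^ s j) y) \<le> K'"
    by (rule transfer[OF x(1) y less_imp_le[OF s(2)]])
  show "y \<in> bungee_set f"
  proof (rule bungee_setI)
    fix N
    obtain j where "j \<ge> N" "norm ((f ^^ s j) y) \<le> K'"
      using K' unfolding frequently_sequentially by blast
    then show "\<exists>n\<ge>N. norm ((f ^^ n) y) \<le> K'"
      using seq_suble[OF s(1), of j] by (intro exI[of _ "s j"]) auto
  next
    fix N :: nat
    show "\<exists>n. real N \<le> norm ((f ^^ n) y)"
    proof (rule ccontr)
      assume "\<not> ?thesis"
      then have y_bdd: "norm ((f ^^ n) y) \<le> real N" for n by (simp add: not_le less_imp_le)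
      have "\<forall>j. \<exists>n. real j \<le> norm ((f ^^ n) x)" using x(2) unfolding bungee_set_iff by blast
      then obtain t where t: "\<And>j. real j \<le> norm ((f ^^ t j) x)" by metis
      obtain K' where "\<exists>\<^sub>F j in sequentially. norm ((f ^^ t j) x) \<le> K'"
        by (rule transfer[OF y x(1) y_bdd])
      moreover obtain M where "K' < real M" using reals_Archimedean2 by blast
      ultimately obtain j where "j \<ge> M" "norm ((f ^^ t j) x) \<le> K'"
        unfolding frequently_sequentially by blast
      then have "real M \<le> K'" using t[of j] by (meson of_nat_mono order_trans)
      then show False using \<open>K' < real M\<close> by simp
    qed
  qed
qed

lemma frontier_fatou_domain_Int_fatou_subset_bungee:
  assumes f: "f holomorphic_on UNIV" and G: "open G" "connected G" "G \<subseteq> fatou_set f"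
    and x: "x \<in> G" "x \<in> bungee_set f"
  shows "frontier G \<inter> fatou_set f \<subseteq> bungee_set f"
proof
  fix y assume "y \<in> frontier G \<inter> fatou_set f"
  then have y: "y \<in> frontier G" "y \<in> fatou_set f" by blast+
  obtain e where e: "e > 0" "ball y e \<subseteq> fatou_set f"
    using y(2) open_fatou_set open_contains_ball by blast
  have "y \<in> closure G" using y(1) by (simp add: frontier_def)
  then have "ball y e \<inter> G \<noteq> {}"
    using open_Int_closure_eq_empty[OF open_ball] e(1) centre_in_ball by blast
  then have "connected (G \<union> ball y e)" using G(2) by (intro connected_Un) auto
  then have "G \<union> ball y e \<subseteq> bungee_set f"
    by (intro fatou_domain_subset_bungee[OF f _ _ _ _ x(2)]) (use G e x in auto)
  then show "y \<in> bungee_set f" using e(1) centre_in_ball by blast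
qed

context log_tract begin

(* Otherwise blowing up inside C would give arbitrarily large domains on whose frontiers f is
   uniformly bounded, so that f would be constant. *)
lemma inside_fatou_continuum_Int_julia:
  assumes C: "compact C" "connected C" "C \<subseteq> fatou_set f"
  shows "inside C \<inter> julia_set f = {}"
proof (rule ccontr)
  assume "inside C \<inter> julia_set f \<noteq> {}"
  note inside = open_inside[OF compact_imp_closed[OF C(1)]]
    bounded_inside[OF compact_imp_bounded[OF C(1)]] this
  have "\<exists>m. (\<exists>x\<in>C. norm ((f ^^ Suc m) x) \<le> norm \<alpha> + r) \<and>
      (\<forall>K z. (\<forall>x\<in>C. norm ((f ^^ Suc m) x) \<le> K) \<longrightarrow> norm z < real j \<longrightarrow> norm (f z) \<le> K)" for j
  proof -
    obtain m D N where N: "tract_pullback (real j) D N"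
        "frontier D \<subseteq> (f ^^ m) ` frontier (inside C)"
      by (rule julia_blow_up_tract_pullback[OF inside])
    have D: "bounded D" "ball 0 (real j) \<subseteq> D" "frontier N \<subseteq> f ` frontier D"
      using N(1) by (auto simp: tract_pullback_def)
    have frD: "frontier D \<subseteq> (f ^^ m) ` C"
      using N(2) frontier_inside_subset[OF compact_imp_closed[OF C(1)]] by blast
    obtain y where "y \<in> frontier N" "y \<in> cball \<alpha> r"
      using tract_pullback_target(4,5)[OF N(1)] by blast
    then obtain x where "x \<in> C" "(f ^^ Suc m) x \<in> cball \<alpha> r" using D(3) frD by fastforce
    then have "\<exists>x\<in>C. norm ((f ^^ Suc m) x) \<le> norm \<alpha> + r" using norm_le_if_mem_cball by blast
    moreover have "norm (f z) \<le> K" if "\<forall>x\<in>C. norm ((f ^^ Suc m) x) \<le> K" "norm z < real j" for K z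
    proof (rule maximum_modulus_frontier[OF holomorphic_on_subset[OF entire] continuous_f D(1)])
      show "norm (f w) \<le> K" if "w \<in> frontier D" for w
        using \<open>\<forall>x\<in>C. _\<close> frD that by auto
      show "z \<in> D" using D(2) \<open>norm z < real j\<close> by auto
    qed auto
    ultimately show ?thesis by blast
  qed
  then obtain m where near: "\<And>j. \<exists>x\<in>C. norm ((f ^^ Suc (m j)) x) \<le> norm \<alpha> + r"
    and bound: "\<And>j K z. (\<forall>x\<in>C. norm ((f ^^ Suc (m j)) x) \<le> K) \<Longrightarrow> norm z < real j \<Longrightarrow> norm (f z) \<le> K"
    by metis
  obtain K where K: "\<exists>\<^sub>F j in sequentially. \<forall>x\<in>C. norm ((f ^^ Suc (m j)) x) \<le> K"
    by (rule bounded_iterates_on_fatou_continuum[where n = "\<lambda>j. Suc (m j)", OF entire C near])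
  have "norm (f z) \<le> K" for z
  proof -
    obtain N where "norm z < real N" using reals_Archimedean2 by blast
    moreover obtain j where "N \<le> j" "\<forall>x\<in>C. norm ((f ^^ Suc (m j)) x) \<le> K"
      using K unfolding frequently_sequentially by blast
    ultimately show ?thesis using bound[of j K z] by simp
  qed
  then have "bounded (range f)" unfolding bounded_iff by blast
  then show False using Liouville_theorem[OF entire] nonconstant by blast
qed

lemma simply_connected_fatou_domain:
  assumes G: "open G" "connected G" "G \<subseteq> fatou_set f" "frontier G \<subseteq> julia_set f"
  shows "simply_connected G"
  unfolding simply_connected_eq_winding_number_zero[OF G(1)]
proof (intro conjI allI impI G(2))
  fix \<gamma> z assume \<gamma>: "path \<gamma> \<and> path_image \<gamma> \<subseteq> G \<and> pathfinish \<gamma> = pathstart \<gamma> \<and> z \<notin> G"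
  let ?C = "path_image \<gamma>"
  have C: "compact ?C" "connected ?C" "?C \<subseteq> fatou_set f"
    using \<gamma> G(3) by (auto simp: compact_path_image connected_path_image)
  have "z \<notin> inside ?C"
  proof
    assume "z \<in> inside ?C"
    moreover have "connected (?C \<union> inside ?C)"
      using C by (simp add: connected_with_inside compact_imp_closed)
    ultimately have "(?C \<union> inside ?C) \<inter> frontier G \<noteq> {}"
      using \<gamma> path_image_nonempty[of \<gamma>] by (intro connected_Int_frontier) auto
    moreover have "?C \<inter> frontier G = {}" using \<gamma> G(1) by (auto simp: frontier_def interior_open)
    ultimately show False using inside_fatou_continuum_Int_julia[OF C] G(4) by blast
  qed
  then have "z \<in> outside ?C" using \<gamma> inside_Un_outside[of ?C] by blast
  then show "winding_number \<gamma> z = 0" using \<gamma> by (simp add: winding_number_zero_in_outside)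
qed

end

section \<open>Mean squares over circles\<close>

abbreviation unit_interval :: "real measure" where
  "unit_interval \<equiv> lebesgue_on {0..1}"

interpretation unit_interval: prob_space unit_interval
  by (rule prob_spaceI) (simp add: emeasure_restrict_space)

lemma measure_unit_interval [simp]: "measure unit_interval {0..1} = 1"
  using unit_interval.prob_space by simp

lemma integrable_unit_interval:
  fixes h :: "real \<Rightarrow> 'a::euclidean_space"
  assumes "continuous_on {0..1} h"
  shows "integrable unit_interval h"
  using continuous_imp_integrable[of 0 1 h] assms by simp

lemma circlepath_in_ball: "0 < \<rho> \<Longrightarrow> \<rho> < R \<Longrightarrow> circlepath 0 \<rho> t \<in> ball 0 R"
  by (simp add: circlepath norm_mult)

lemma continuous_on_circle:
  assumes "continuous_on (ball 0 R) h" "0 < \<rho>" "\<rho> < R"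
  shows "continuous_on {0..1} (\<lambda>t. h (circlepath 0 \<rho> t))"
proof (rule continuous_on_compose2[OF assms(1)])
  show "continuous_on {0..1} (circlepath 0 \<rho>)" unfolding circlepath by (intro continuous_intros)
qed (use circlepath_in_ball assms(2,3) in blast)

lemma mean_value_circle:
  assumes h: "h holomorphic_on ball 0 R" and \<rho>: "0 < \<rho>" "\<rho> < R"
  shows "(LINT t|unit_interval. h (circlepath 0 \<rho> t)) = h 0"
proof -
  have "((\<lambda>w. h w / (w - 0)) has_contour_integral (2 * of_real pi * \<i> * h 0)) (circlepath 0 \<rho>)"
    by (rule Cauchy_integral_circlepath_simple)
        (use \<rho> in \<open>auto intro!: holomorphic_on_subset[OF h]\<close>)
  then have "((\<lambda>t. h (circlepath 0 \<rho> t) / circlepath 0 \<rho> t *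
      vector_derivative (circlepath 0 \<rho>) (at t within {0..1}))
      has_integral (2 * of_real pi * \<i> * h 0)) {0..1}"
    by (simp add: has_contour_integral_def)
  then have "((\<lambda>t. 2 * of_real pi * \<i> * h (circlepath 0 \<rho> t))
      has_integral (2 * of_real pi * \<i> * h 0)) {0..1}"
  proof (rule has_integral_eq[rotated])
    fix t :: real assume "t \<in> {0..1}"
    then have "vector_derivative (circlepath 0 \<rho>) (at t within {0..1})
        = 2 * pi * \<i> * \<rho> * exp (2 * of_real pi * \<i> * t)"
      by (intro vector_derivative_circlepath01) auto
    then show "h (circlepath 0 \<rho> t) / circlepath 0 \<rho> t *
        vector_derivative (circlepath 0 \<rho>) (at t within {0..1})
        = 2 * of_real pi * \<i> * h (circlepath 0 \<rho> t)"
      using \<rho> by (simp add: circlepath)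
  qed
  then have "((\<lambda>t. h (circlepath 0 \<rho> t)) has_integral h 0) {0..1}"
    using has_integral_mult_right[of "\<lambda>t. 2 * of_real pi * \<i> * h (circlepath 0 \<rho> t)"
        "2 * of_real pi * \<i> * h 0"
        "{0..1}" "inverse (2 * of_real pi * \<i>)"] by (simp add: field_simps)
  moreover have "integrable unit_interval (\<lambda>t. h (circlepath 0 \<rho> t))"
    by (intro integrable_unit_interval
        continuous_on_circle[OF holomorphic_on_imp_continuous_on[OF h] \<rho>])
  ultimately show ?thesis
    by (simp add: lebesgue_integral_eq_integral integral_unique)
qed

definition circle_mean_square :: "(complex \<Rightarrow> complex) \<Rightarrow> real \<Rightarrow> real" where
  "circle_mean_square h \<rho> = (LINT t|unit_interval. (norm (h (circlepath 0 \<rho> t)))\<^sup>2)"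

lemma parseval_polynomial:
  fixes c :: "nat \<Rightarrow> complex"
  shows "circle_mean_square (\<lambda>z. \<Sum>n<N. c n * z ^ n) 1 = (\<Sum>n<N. (norm (c n))\<^sup>2)"
proof (induction N)
  case (Suc N)
  define E where "E t = circlepath 0 1 t" for t
  define S where "S z = (\<Sum>n<N. c n * z ^ n)" for z
  define h where "h z = c N * (\<Sum>n<N. cnj (c n) * z ^ (N - n))" for z
  have norm_E: "norm (E t) = 1" and E_cnj: "E t * cnj (E t) = 1" for t
    using complex_norm_square[of "E t"] by (simp_all add: E_def circlepath)
  have cross: "c N * E t ^ N * cnj (S (E t)) = h (E t)" for t
  proof -
    have "E t ^ N * cnj (E t ^ n) = E t ^ (N - n)" if "n < N" for n
    proof -
      have "E t ^ N = E t ^ (N - n) * E t ^ n" using that by (simp flip: power_add)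
      then show ?thesis using E_cnj[of t] by (simp flip: power_mult_distrib add: mult.assoc)
    qed
    then show ?thesis
      unfolding S_def h_def by (auto simp: sum_distrib_left mult_ac intro!: sum.cong)
  qed
  have "norm (S (E t) + c N * E t ^ N) ^ 2
      = norm (S (E t)) ^ 2 + norm (c N) ^ 2 + 2 * Re (h (E t))" for t
  proof -
    have "norm (a + b) ^ 2 = norm a ^ 2 + norm b ^ 2 + 2 * Re (b * cnj a)" for a b :: complex
      unfolding cmod_power2 by (simp add: power2_eq_square algebra_simps)
    then show ?thesis
      using norm_E[of t] unfolding cross[symmetric] by (simp add: norm_mult norm_power)
  qed
  moreover have "continuous_on {0..1} E" unfolding E_def circlepath by (intro continuous_intros)
  then have "integrable unit_interval (\<lambda>t. norm (S (E t)) ^ 2)"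
      "integrable unit_interval (\<lambda>t. h (E t))"
    by (auto intro!: integrable_unit_interval continuous_intros simp: S_def h_def)
  moreover have "(LINT t|unit_interval. h (E t)) = h 0"
    unfolding E_def
    by (rule mean_value_circle[of h 2]) (auto intro!: holomorphic_intros simp: h_def[abs_def])
  moreover have "h 0 = 0" by (auto simp: h_def intro!: sum.neutral)
  ultimately show ?case
    using Suc by (simp add: circle_mean_square_def integral_Re flip: S_def E_def)
qed (simp add: circle_mean_square_def)

lemma parseval_summable:
  fixes c :: "nat \<Rightarrow> complex"
  assumes "summable (\<lambda>n. norm (c n))"
  shows "(\<lambda>n. (norm (c n))\<^sup>2) sums circle_mean_square (\<lambda>z. \<Sum>n. c n * z ^ n) 1"
proof -
  define E where "E t = circlepath 0 1 t" for t
  have norm_E: "norm (E t) = 1" for t by (simp add: E_def circlepath)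
  have cont_E: "continuous_on {0..1} E" unfolding E_def circlepath by (intro continuous_intros)
  have "summable (\<lambda>n. c n * E t ^ n)" for t
    by (rule summable_norm_cancel) (use assms norm_E in \<open>simp add: norm_mult norm_power\<close>)
  then have lim: "(\<lambda>N. (norm (\<Sum>n<N. c n * E t ^ n))\<^sup>2) \<longlonglongrightarrow> (norm (\<Sum>n. c n * E t ^ n))\<^sup>2" for t
    by (intro tendsto_intros summable_LIMSEQ)
  have bound: "(norm (\<Sum>n<N. c n * E t ^ n))\<^sup>2 \<le> (\<Sum>n. norm (c n))\<^sup>2" for N t
  proof (rule power_mono)
    have "norm (\<Sum>n<N. c n * E t ^ n) \<le> (\<Sum>n<N. norm (c n))"
      by (rule order_trans[OF norm_sum]) (simp add: norm_E norm_mult norm_power)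
    also have "\<dots> \<le> (\<Sum>n. norm (c n))" by (rule sum_le_suminf[OF assms]) auto
    finally show "norm (\<Sum>n<N. c n * E t ^ n) \<le> (\<Sum>n. norm (c n))" .
  qed simp
  have meas: "(\<lambda>t. (norm (\<Sum>n<N. c n * E t ^ n))\<^sup>2) \<in> borel_measurable unit_interval" for N
    by (intro borel_measurable_integrable integrable_unit_interval continuous_intros cont_E)
  have "(\<lambda>N. LINT t|unit_interval. (norm (\<Sum>n<N. c n * E t ^ n))\<^sup>2)
      \<longlonglongrightarrow> (LINT t|unit_interval. (norm (\<Sum>n. c n * E t ^ n))\<^sup>2)"
  proof (rule integral_dominated_convergence[where w = "\<lambda>_. (\<Sum>n. norm (c n))\<^sup>2"])
    show "(\<lambda>t. (norm (\<Sum>n. c n * E t ^ n))\<^sup>2) \<in> borel_measurable unit_interval"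
      by (rule borel_measurable_LIMSEQ_metric[OF meas lim])
  qed (use meas lim bound in auto)
  then show ?thesis
    by (simp add: sums_def E_def circle_mean_square_def flip: parseval_polynomial)
qed

lemma parseval_circle:
  assumes series: "\<And>z. norm z < R \<Longrightarrow> (\<lambda>n. c n * z ^ n) sums h z" and \<rho>: "0 < \<rho>" "\<rho> < R"
  shows "(\<lambda>n. (norm (c n) * \<rho> ^ n)\<^sup>2) sums circle_mean_square h \<rho>"
proof -
  obtain x where x: "\<rho> < x" "x < R" using \<rho>(2) dense by blast
  have "summable (\<lambda>n. c n * of_real x ^ n)"
    using series[of "of_real x"] x \<rho>(1) by (auto dest: sums_summable)
  then have "summable (\<lambda>n. norm (c n * of_real \<rho> ^ n))" by (rule powser_insidea) (use x \<rho> in auto)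
  from parseval_summable[OF this]
  have "(\<lambda>n. (norm (c n) * \<rho> ^ n)\<^sup>2)
      sums circle_mean_square (\<lambda>z. \<Sum>n. c n * of_real \<rho> ^ n * z ^ n) 1"
    using \<rho>(1) by (simp add: norm_mult norm_power)
  moreover have "(\<Sum>n. c n * of_real \<rho> ^ n * circlepath 0 1 t ^ n) = h (circlepath 0 \<rho> t)" for t
  proof -
    have "circlepath 0 \<rho> t = of_real \<rho> * circlepath 0 1 t" by (simp add: circlepath)
    moreover have "norm (circlepath 0 \<rho> t) < R" using circlepath_in_ball[OF \<rho>] by simp
    ultimately show ?thesis
      using series[of "circlepath 0 \<rho> t"] by (simp add: sums_iff power_mult_distrib mult.assoc)
  qed
  ultimately show ?thesis by (simp add: circle_mean_square_def)
qed

lemma circle_mean_square_le: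
  assumes "continuous_on (ball 0 R) h" "\<And>z. z \<in> ball 0 R \<Longrightarrow> norm (h z) \<le> B" "0 < \<rho>" "\<rho> < R"
  shows "circle_mean_square h \<rho> \<le> B\<^sup>2"
proof -
  have "circle_mean_square h \<rho> \<le> (LINT t|unit_interval. B\<^sup>2)"
    unfolding circle_mean_square_def
    by (intro integral_mono integrable_unit_interval continuous_intros power_mono
        continuous_on_circle[OF assms(1,3,4)] assms(2) circlepath_in_ball[OF assms(3,4)]) simp
  then show ?thesis by simp
qed

(* By Parseval both sides are sums over n of |a n|^2 (x^n - s^n)^2 and |a n|^2 (x^(2n) - s^(2n)). *)
lemma circle_mean_square_diff_le:
  assumes h: "h holomorphic_on ball 0 R" and s: "0 < s" "s \<le> x" "x < R"
  shows "(LINT t|unit_interval. (norm (h (circlepath 0 x t) - h (circlepath 0 s t)))\<^sup>2)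
    \<le> circle_mean_square h x - circle_mean_square h s"
proof -
  define a where "a n = (deriv ^^ n) h 0 / fact n" for n
  have series: "(\<lambda>n. a n * z ^ n) sums h z" if "norm z < R" for z
    using holomorphic_power_series[OF h, of z] that by (simp add: a_def)
  define d where "d z = h (of_real x * z) - h (of_real s * z)" for z
  have d_series: "(\<lambda>n. a n * (of_real x ^ n - of_real s ^ n) * z ^ n) sums d z"
      if "norm z < R / x" for z
  proof -
    have "norm z * x < R" using that s by (simp add: field_simps)
    moreover from this have "norm z * s < R"
      using s(2) by (meson le_less_trans mult_left_mono norm_ge_zero)
    ultimately show ?thesis
      unfolding d_def
      using sums_diff[OF series[of "of_real x * z"] series[of "of_real s * z"]] s
      by (simp add: norm_mult mult.commute power_mult_distrib algebra_simps)
  qed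
  have "(\<lambda>n. (norm (a n * (of_real x ^ n - of_real s ^ n)) * 1 ^ n)\<^sup>2) sums circle_mean_square d 1"
    by (rule parseval_circle[OF d_series]) (use s in auto)
  then have sums_d: "(\<lambda>n. (norm (a n * (of_real x ^ n - of_real s ^ n)))\<^sup>2)
      sums circle_mean_square d 1"
    by simp
  have mean_d: "circle_mean_square d 1 =
      (LINT t|unit_interval. (norm (h (circlepath 0 x t) - h (circlepath 0 s t)))\<^sup>2)"
    by (simp add: circle_mean_square_def d_def circlepath)
  have sums_diff: "(\<lambda>n. (norm (a n) * x ^ n)\<^sup>2 - (norm (a n) * s ^ n)\<^sup>2) sums
      (circle_mean_square h x - circle_mean_square h s)"
    by (intro Series.sums_diff parseval_circle[OF series]) (use s in auto)
  have "(norm (a n * (of_real x ^ n - of_real s ^ n)))\<^sup>2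
      \<le> (norm (a n) * x ^ n)\<^sup>2 - (norm (a n) * s ^ n)\<^sup>2" for n
  proof -
    have "(x ^ n - s ^ n)\<^sup>2 \<le> (x ^ n)\<^sup>2 - (s ^ n)\<^sup>2"
      using mult_right_mono[of "s ^ n" "x ^ n" "s ^ n"] s
      by (simp add: power_mono power2_eq_square algebra_simps)
    moreover have "norm (of_real x ^ n - of_real s ^ n :: complex) = \<bar>x ^ n - s ^ n\<bar>"
      by (metis norm_of_real of_real_diff of_real_power)
    ultimately show ?thesis
      using mult_left_mono[of _ _ "(norm (a n))\<^sup>2"]
      by (simp add: norm_mult power_mult_distrib flip: right_diff_distrib)
  qed
  from sums_le[OF this sums_d sums_diff] show ?thesis by (simp add: mean_d)
qed

section \<open>Boundary values of bounded holomorphic functions\<close>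

lemma AE_convergent_if_summable_increments:
  fixes u :: "nat \<Rightarrow> 'a \<Rightarrow> 'b::{banach, second_countable_topology}"
  assumes u: "\<And>j. integrable M (u j)"
    and summ: "summable (\<lambda>j. LINT x|M. norm (u (Suc j) x - u j x))"
  shows "AE x in M. convergent (\<lambda>j. u j x)"
proof -
  define d where "d j x = norm (u (Suc j) x - u j x)" for j x
  have d: "integrable M (d j)" for j unfolding d_def using u by auto
  have "(\<integral>\<^sup>+x. (\<Sum>j. ennreal (d j x)) \<partial>M) = (\<Sum>j. \<integral>\<^sup>+x. ennreal (d j x) \<partial>M)"
    using d by (intro nn_integral_suminf) auto
  also have "\<dots> = (\<Sum>j. ennreal (LINT x|M. d j x))"
    by (intro suminf_cong nn_integral_eq_integral d) (simp add: d_def)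
  also have "\<dots> = ennreal (\<Sum>j. LINT x|M. d j x)"
    using summ by (intro suminf_ennreal2) (auto simp: d_def)
  finally have "AE x in M. (\<Sum>j. ennreal (d j x)) \<noteq> \<infinity>"
    using d by (intro nn_integral_noteq_infinite) auto
  then show ?thesis
  proof eventually_elim
    case (elim x)
    then have "summable (\<lambda>j. d j x)" by (intro summable_suminf_not_top) (auto simp: d_def)
    then have "summable (\<lambda>j. u (Suc j) x - u j x)" unfolding d_def by (rule summable_norm_cancel)
    then have "convergent (\<lambda>n. u n x - u 0 x)"
      by (simp add: summable_iff_convergent sum_lessThan_telescope[of "\<lambda>n. u n x"])
    then show ?case using convergent_add[OF _ convergent_const[of "u 0 x"]] by fastforce
  qed
qed

lemma (in prob_space) expectation_le_if_square:
  fixes X :: "'a \<Rightarrow> real"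
  assumes "integrable M X" "integrable M (\<lambda>x. (X x)\<^sup>2)" "expectation (\<lambda>x. (X x)\<^sup>2) \<le> b\<^sup>2" "0 \<le> b"
  shows "expectation X \<le> b"
proof (rule power2_le_imp_le)
  show "(expectation X)\<^sup>2 \<le> b\<^sup>2"
    using variance_eq[OF assms(1,2)] variance_positive[of X] assms(3) by linarith
qed (fact assms(4))

lemma bounded_mono_fast_sequence:
  fixes I :: "real \<Rightarrow> real"
  assumes mono: "\<And>s x. \<lbrakk>0 < s; s \<le> x; x < 1\<rbrakk> \<Longrightarrow> I s \<le> I x"
    and bdd: "\<And>x. \<lbrakk>0 < x; x < 1\<rbrakk> \<Longrightarrow> I x \<le> B" and \<epsilon>: "\<And>j::nat. \<epsilon> j > 0"
  obtains \<rho> where "\<And>j. 0 < \<rho> j" "\<And>j. \<rho> j < 1" "incseq \<rho>" "\<rho> \<longlonglongrightarrow> 1"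
    "\<And>j. I (\<rho> (Suc j)) - I (\<rho> j) \<le> \<epsilon> j"
proof -
  define L where "L = (SUP x\<in>{0<..<1}. I x)"
  have bdd_above: "bdd_above (I ` {0<..<1})" using bdd by (auto intro!: bdd_aboveI)
  have I_le: "I x \<le> L" if "0 < x" "x < 1" for x
    unfolding L_def using that by (intro cSUP_upper bdd_above) auto
  have near_sup: "\<exists>y. 0 < y \<and> y < 1 \<and> L - \<epsilon> j < I y" for j
    using less_cSUP_iff[OF _ bdd_above, of "L - \<epsilon> j"] \<epsilon>[of j] by (auto simp: L_def)
  define good where "good j x \<longleftrightarrow> 0 < x \<and> x < 1 \<and> 1 - 1 / real (Suc j) \<le> x \<and> L - \<epsilon> j \<le> I x" for j x
  have step: "\<exists>y. good j y \<and> x \<le> y" if "x < 1" for j x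
  proof -
    obtain y where y: "0 < y" "y < 1" "L - \<epsilon> j < I y" using near_sup by blast
    define w where "w = max (max x y) (1 - 1 / real (Suc j))"
    have w: "0 < w" "w < 1" "x \<le> w" "y \<le> w" "1 - 1 / real (Suc j) \<le> w"
      unfolding w_def using y that by auto
    then show ?thesis using mono[of y w] y by (intro exI[of _ w]) (auto simp: good_def)
  qed
  have "\<exists>\<rho>. \<forall>j. good j (\<rho> j) \<and> \<rho> j \<le> \<rho> (Suc j)"
  proof (rule dependent_nat_choice)
    show "\<exists>x. good 0 x" using step[of 0 0] by auto
    show "\<exists>y. good (Suc j) y \<and> x \<le> y" if "good j x" for x j
      using that by (intro step) (simp add: good_def)
  qed
  then obtain \<rho> where \<rho>: "\<And>j. good j (\<rho> j)" "\<And>j. \<rho> j \<le> \<rho> (Suc j)" by blast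
  show ?thesis
  proof (rule that)
    show bounds: "0 < \<rho> j" "\<rho> j < 1" for j using \<rho>(1)[of j] by (auto simp: good_def)
    show "incseq \<rho>" using \<rho>(2) by (simp add: incseq_SucI)
    show "\<rho> \<longlonglongrightarrow> 1"
    proof (rule tendsto_sandwich)
      show "(\<lambda>j. 1 - 1 / real (Suc j)) \<longlonglongrightarrow> 1" by real_asymp
    qed (use \<rho>(1) in \<open>auto simp: good_def less_imp_le\<close>)
    show "I (\<rho> (Suc j)) - I (\<rho> j) \<le> \<epsilon> j" for j
      using I_le[OF bounds, of "Suc j"] \<rho>(1)[of j] by (simp add: good_def)
  qed
qed

lemma radial_limits_along_sequence:
  fixes \<phi> :: "complex \<Rightarrow> complex"
  assumes hol: "\<phi> holomorphic_on ball 0 1" and bdd: "\<And>z. z \<in> ball 0 1 \<Longrightarrow> norm (\<phi> z) \<le> B"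
  obtains \<rho> where "\<And>j. 0 < \<rho> j" "\<And>j. \<rho> j < 1" "\<rho> \<longlonglongrightarrow> 1"
    "AE t in unit_interval. convergent (\<lambda>j. \<phi> (circlepath 0 (\<rho> j) t))"
proof -
  have cont: "continuous_on (ball 0 1) \<phi>" using hol by (rule holomorphic_on_imp_continuous_on)
  have increment: "0 \<le> circle_mean_square \<phi> x - circle_mean_square \<phi> s"
      if "0 < s" "s \<le> x" "x < 1" for s x
    by (rule order_trans[OF _ circle_mean_square_diff_le[OF hol that]])
        (simp add: integral_nonneg_AE)
  then have mono: "circle_mean_square \<phi> s \<le> circle_mean_square \<phi> x"
      if "0 < s" "s \<le> x" "x < 1" for s x
    using that by force
  obtain \<rho> where \<rho>: "\<And>j. 0 < \<rho> j" "\<And>j. \<rho> j < 1" "incseq \<rho>" "\<rho> \<longlonglongrightarrow> 1"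
    and fast: "\<And>j. circle_mean_square \<phi> (\<rho> (Suc j)) - circle_mean_square \<phi> (\<rho> j) \<le> ((1/2) ^ j)\<^sup>2"
    by (rule bounded_mono_fast_sequence[of "circle_mean_square \<phi>" "B\<^sup>2" "\<lambda>j. ((1/2) ^ j)\<^sup>2"])
       (use mono circle_mean_square_le[OF cont bdd] in auto)
  define u where "u j t = \<phi> (circlepath 0 (\<rho> j) t)" for j t
  have cont_u: "continuous_on {0..1} (u j)" for j
    unfolding u_def using \<rho>(1,2) by (rule continuous_on_circle[OF cont])
  have small: "(LINT t|unit_interval. norm (u (Suc j) t - u j t)) \<le> (1/2) ^ j" for j
  proof (rule unit_interval.expectation_le_if_square)
    have "(LINT t|unit_interval. (norm (u (Suc j) t - u j t))\<^sup>2)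
        \<le> circle_mean_square \<phi> (\<rho> (Suc j)) - circle_mean_square \<phi> (\<rho> j)"
      unfolding u_def using \<rho> by (intro circle_mean_square_diff_le[OF hol]) (auto simp: incseq_SucD)
    then show "(LINT t|unit_interval. (norm (u (Suc j) t - u j t))\<^sup>2) \<le> ((1/2) ^ j)\<^sup>2"
      using fast[of j] by linarith
  qed (auto intro!: integrable_unit_interval continuous_intros cont_u)
  have "AE t in unit_interval. convergent (\<lambda>j. u j t)"
  proof (rule AE_convergent_if_summable_increments)
    show "integrable unit_interval (u j)" for j by (rule integrable_unit_interval[OF cont_u])
    have "norm (LINT t|unit_interval. norm (u (Suc j) t - u j t)) \<le> (1/2) ^ j" for j
      using small[of j] by (simp add: integral_nonneg_AE)
    then show "summable (\<lambda>j. LINT t|unit_interval. norm (u (Suc j) t - u j t))"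
      by (intro summable_comparison_test'[OF summable_geometric[of "1/2 :: real"], of 0]) auto
  qed
  then show ?thesis unfolding u_def by (rule that[OF \<rho>(1,2,4)])
qed

section \<open>Harmonic measure\<close>

lemma (in finite_measure) measure_eventually_le:
  assumes A: "\<And>n::nat. A n \<in> sets M" and small: "\<exists>\<^sub>F n in sequentially. measure M (A n) \<le> b"
  shows "measure M {x \<in> space M. \<forall>\<^sub>F n in sequentially. x \<in> A n} \<le> b"
proof -
  define E where "E N = (\<Inter>n\<in>{N..}. A n)" for N
  have E: "E N \<in> sets M" for N unfolding E_def using A by (intro sets.countable_INT) auto
  have "measure M (E N) \<le> b" for N
  proof -
    obtain n where "n \<ge> N" "measure M (A n) \<le> b"
      using small unfolding frequently_sequentially by blast
    moreover from this have "measure M (E N) \<le> measure M (A n)"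
      by (intro finite_measure_mono A) (auto simp: E_def)
    ultimately show ?thesis by linarith
  qed
  moreover have "(\<lambda>N. measure M (E N)) \<longlonglongrightarrow> measure M (\<Union>N. E N)"
    by (rule finite_Lim_measure_incseq) (use E in \<open>auto simp: incseq_def E_def\<close>)
  ultimately have "measure M (\<Union>N. E N) \<le> b" by (intro LIMSEQ_le_const2) auto
  moreover have "{x \<in> space M. \<forall>\<^sub>F n in sequentially. x \<in> A n} = (\<Union>N. E N)"
    using sets.sets_into_space[OF A] by (auto simp: E_def eventually_sequentially)
  ultimately show ?thesis by simp
qed

lemma (in finite_measure) measure_limit_in_open_le:
  fixes X :: "'a \<Rightarrow> 'b::topological_space"
  assumes Y: "\<And>n. Y n \<in> borel_measurable M" "AE x in M. (\<lambda>n. Y n x) \<longlonglongrightarrow> X x" and Q: "open Q"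
    and small: "\<And>n::nat. measure M {x \<in> space M. Y n x \<in> Q} \<le> b"
  shows "measure M {x \<in> space M. X x \<in> Q} \<le> b"
proof -
  define A where "A n = {x \<in> space M. Y n x \<in> Q}" for n
  have A: "A n \<in> sets M" for n
    using measurable_sets[OF Y(1) borel_open[OF Q]]
    by (simp add: A_def vimage_def Int_def conj_commute)
  have "measure M {x \<in> space M. X x \<in> Q} \<le> measure M {x \<in> space M. \<forall>\<^sub>F n in sequentially. x \<in> A n}"
  proof (rule finite_measure_mono_AE)
    show "AE x in M. x \<in> {x \<in> space M. X x \<in> Q} \<longrightarrow> x \<in> {x \<in> space M. \<forall>\<^sub>F n in sequentially. x \<in> A n}"
      using Y(2) by eventually_elim (use Q in \<open>auto simp: A_def dest: topological_tendstoD\<close>)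
  qed (use A in measurable)
  also have "\<dots> \<le> b" by (rule measure_eventually_le[OF A]) (use small in \<open>auto simp: A_def\<close>)
  finally show ?thesis .
qed

lemma measure_small_values_circle:
  assumes g: "g holomorphic_on ball 0 1" "\<And>z. z \<in> ball 0 1 \<Longrightarrow> g z \<noteq> 0 \<and> norm (g z) \<le> 1"
    and \<rho>: "0 < \<rho>" "\<rho> < 1" and \<tau>: "0 < \<tau>" "\<tau> < 1"
  shows "measure unit_interval {t \<in> {0..1}. norm (g (circlepath 0 \<rho> t)) \<le> \<tau>}
      \<le> ln (norm (g 0)) / ln \<tau>"
proof -
  have "simply_connected (ball (0::complex) 1)" by (simp add: convex_imp_simply_connected)
  then obtain h where h: "h holomorphic_on ball 0 1" "\<And>z. z \<in> ball 0 1 \<Longrightarrow> g z = exp (h z)"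
    using simply_connected_eq_holomorphic_log[of "ball (0::complex) 1"] g by auto
  have norm_g: "norm (g z) = exp (Re (h z))" if "z \<in> ball 0 1" for z
    using h(2)[OF that] by simp
  define u where "u t = - Re (h (circlepath 0 \<rho> t))" for t
  have int_h: "integrable unit_interval (\<lambda>t. h (circlepath 0 \<rho> t))"
    by (intro integrable_unit_interval
        continuous_on_circle[OF holomorphic_on_imp_continuous_on[OF h(1)] \<rho>])
  have g_circle: "norm (g (circlepath 0 \<rho> t)) = exp (- u t)" for t
    using norm_g[OF circlepath_in_ball[OF \<rho>]] by (simp add: u_def)
  have u_nonneg: "u t \<ge> 0" for t
    using g(2)[OF circlepath_in_ball[OF \<rho>], of t] by (simp add: g_circle)
  have "(LINT t|unit_interval. u t) = - Re (h 0)"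
    using mean_value_circle[OF h(1) \<rho>] int_h unfolding u_def by (simp add: integral_Re)
  also have "\<dots> = - ln (norm (g 0))" using norm_g[of 0] by simp
  finally have mean_u: "(LINT t|unit_interval. u t) = - ln (norm (g 0))" .
  have "measure unit_interval {t \<in> space unit_interval. u t \<ge> - ln \<tau>}
      \<le> (LINT t|unit_interval. u t) / (- ln \<tau>)"
    by (rule integral_Markov_inequality_measure[OF _ sets.top])
       (use u_nonneg \<tau> int_h in \<open>auto simp: u_def\<close>)
  moreover have "norm (g (circlepath 0 \<rho> t)) \<le> \<tau> \<longleftrightarrow> u t \<ge> - ln \<tau>" for t
    unfolding g_circle using \<tau> by (metis exp_le_cancel_iff exp_ln neg_le_iff_le minus_minus)
  ultimately show ?thesis by (simp add: mean_u)
qed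

lemma Riemann_map_at:
  assumes "open G" "simply_connected G" "G \<noteq> UNIV" "z0 \<in> G"
  obtains \<phi> F where "\<phi> holomorphic_on ball 0 1" "\<phi> ` ball 0 1 \<subseteq> G" "\<phi> 0 = z0"
    "F holomorphic_on G" "F ` G \<subseteq> ball 0 1" "\<And>z. z \<in> ball 0 1 \<Longrightarrow> F (\<phi> z) = z"
proof -
  obtain F \<phi> where F: "F holomorphic_on G" "\<And>z. z \<in> G \<Longrightarrow> F z \<in> ball 0 1 \<and> \<phi> (F z) = z"
    and \<phi>: "\<phi> holomorphic_on ball 0 1" "\<And>z. z \<in> ball 0 1 \<Longrightarrow> \<phi> z \<in> G \<and> F (\<phi> z) = z"
    using assms simply_connected_eq_biholomorphic_to_disc[OF assms(1)] by blast
  obtain S T where ST: "S (F z0) = 0" "S holomorphic_on ball 0 1" "S ` ball 0 1 \<subseteq> ball 0 1"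
      "T holomorphic_on ball 0 1" "T ` ball 0 1 \<subseteq> ball 0 1"
      "\<And>z. z \<in> ball 0 1 \<Longrightarrow> S (T z) = z" "\<And>z. z \<in> ball 0 1 \<Longrightarrow> T (S z) = z"
    using ball_biholomorphism_exists F(2)[OF assms(4)] by metis
  show ?thesis
  proof (rule that)
    show "(\<phi> \<circ> T) holomorphic_on ball 0 1"
      using ST(4) \<phi>(1) ST(5) by (rule holomorphic_on_compose_gen)
    show "(\<phi> \<circ> T) ` ball 0 1 \<subseteq> G" using \<phi>(2) ST(5) by fastforce
    show "(\<phi> \<circ> T) 0 = z0" using ST(7)[of "F z0"] F(2)[OF assms(4)] by (simp add: ST(1))
    show "(S \<circ> F) holomorphic_on G" using F ST(2) by (intro holomorphic_on_compose_gen) auto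
    show "(S \<circ> F) ` G \<subseteq> ball 0 1" using F(2) ST(3) by fastforce
    show "(S \<circ> F) ((\<phi> \<circ> T) z) = z" if "z \<in> ball 0 1" for z
      using \<phi>(2) ST(5,6) that by (auto simp: image_subset_iff)
  qed
qed

lemma limit_in_frontier_if_norm_tendsto_1:
  fixes y :: "nat \<Rightarrow> complex"
  assumes G: "open G" "\<And>j. y j \<in> G" and F: "F holomorphic_on G" "F ` G \<subseteq> ball 0 1"
    and lim: "y \<longlonglongrightarrow> x" "(\<lambda>j. norm (F (y j))) \<longlonglongrightarrow> 1"
  shows "x \<in> frontier G"
proof -
  have "x \<notin> G"
  proof
    assume "x \<in> G"
    then have "isCont F x"
      using F(1) G(1) holomorphic_on_imp_continuous_on continuous_on_eq_continuous_at by blast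
    then have "(\<lambda>j. norm (F (y j))) \<longlonglongrightarrow> norm (F x)"
      by (intro tendsto_norm isCont_tendsto_compose[OF _ lim(1)])
    then have "norm (F x) = 1" using lim(2) LIMSEQ_unique by blast
    then show False using F(2) \<open>x \<in> G\<close> by (auto simp: image_subset_iff)
  qed
  moreover have "x \<in> closure G" using lim(1) G(2) by (meson closure_sequential)
  ultimately show ?thesis using G(1) by (simp add: frontier_def interior_open)
qed

lemma Riemann_map_boundary_values:
  assumes G: "open G" "simply_connected G" "bounded G" "z0 \<in> G"
  obtains \<phi> \<rho> X where "\<phi> holomorphic_on ball 0 1" "\<phi> ` ball 0 1 \<subseteq> G" "\<phi> 0 = z0"
    "\<And>j. 0 < \<rho> j" "\<And>j::nat. \<rho> j < 1" "X \<in> borel_measurable unit_interval"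
    "AE t in unit_interval. (\<lambda>j. \<phi> (circlepath 0 (\<rho> j) t)) \<longlonglongrightarrow> X t"
    "AE t in unit_interval. X t \<in> frontier G"
proof -
  have "G \<noteq> UNIV" using G(3) by auto
  obtain \<phi> F where \<phi>: "\<phi> holomorphic_on ball 0 1" "\<phi> ` ball 0 1 \<subseteq> G" "\<phi> 0 = z0"
    and F: "F holomorphic_on G" "F ` G \<subseteq> ball 0 1" "\<And>z. z \<in> ball 0 1 \<Longrightarrow> F (\<phi> z) = z"
    by (rule Riemann_map_at[OF G(1,2) \<open>G \<noteq> UNIV\<close> G(4)]) blast
  obtain B where B: "\<And>z. z \<in> G \<Longrightarrow> norm z \<le> B" using G(3) unfolding bounded_iff by blast
  obtain \<rho> where \<rho>: "\<And>j::nat. 0 < \<rho> j" "\<And>j. \<rho> j < 1" "\<rho> \<longlonglongrightarrow> 1"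
    and conv: "AE t in unit_interval. convergent (\<lambda>j. \<phi> (circlepath 0 (\<rho> j) t))"
    using radial_limits_along_sequence[OF \<phi>(1), of B] B \<phi>(2) by (metis image_subset_iff)
  define Y where "Y j t = \<phi> (circlepath 0 (\<rho> j) t)" for j t
  define X where "X t = lim (\<lambda>j. Y j t)" for t
  have in_ball: "circlepath 0 (\<rho> j) t \<in> ball 0 1" for j t by (rule circlepath_in_ball[OF \<rho>(1,2)])
  have Y_in_G: "Y j t \<in> G" for j t using in_ball \<phi>(2) by (auto simp: Y_def)
  have Y_meas: "Y j \<in> borel_measurable unit_interval" for j
    unfolding Y_def
    by (intro borel_measurable_integrable integrable_unit_interval
        continuous_on_circle[OF holomorphic_on_imp_continuous_on[OF \<phi>(1)] \<rho>(1,2)])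
  have lim_Y: "AE t in unit_interval. (\<lambda>j. Y j t) \<longlonglongrightarrow> X t"
    using conv unfolding X_def Y_def by (simp add: convergent_LIMSEQ_iff)
  show ?thesis
  proof (rule that[OF \<phi> \<rho>(1,2)])
    show "X \<in> borel_measurable unit_interval"
      unfolding X_def by (rule borel_measurable_lim_metric[OF Y_meas])
    show "AE t in unit_interval. (\<lambda>j. \<phi> (circlepath 0 (\<rho> j) t)) \<longlonglongrightarrow> X t"
      using lim_Y by (simp add: Y_def)
    show "AE t in unit_interval. X t \<in> frontier G"
      using lim_Y
    proof eventually_elim
      case (elim t)
      have "norm (F (Y j t)) = \<rho> j" for j
        using F(3)[OF in_ball] \<rho>(1)[of j] by (simp add: Y_def circlepath norm_mult)
      then show ?case
        using \<rho>(3) by (intro limit_in_frontier_if_norm_tendsto_1[OF G(1) Y_in_G F(1,2) elim]) simp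
    qed
  qed
qed

(* The qualitative content of the two constants theorem, with \<omega> in the role of the harmonic
   measure of G at z0. *)
definition two_constants_property :: "complex set \<Rightarrow> complex \<Rightarrow> complex measure \<Rightarrow> bool" where
  "two_constants_property G z0 \<omega> \<longleftrightarrow>
     (\<forall>a>0. \<forall>\<epsilon>>0. \<exists>\<tau>>0. \<forall>g Q. g holomorphic_on G \<and> (\<forall>z\<in>G. g z \<noteq> 0 \<and> norm (g z) \<le> 1) \<and>
        a \<le> norm (g z0) \<and> open Q \<and> (\<forall>z\<in>G \<inter> Q. norm (g z) \<le> \<tau>) \<longrightarrow> measure \<omega> Q \<le> \<epsilon>)"

lemma two_constants_propertyE:
  assumes "two_constants_property G z0 \<omega>" "0 < a" "0 < \<epsilon>"
  obtains \<tau> where "0 < \<tau>"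
    "\<And>g Q. \<lbrakk>g holomorphic_on G; \<And>z. z \<in> G \<Longrightarrow> g z \<noteq> 0 \<and> norm (g z) \<le> 1; a \<le> norm (g z0); open Q;
       \<And>z. \<lbrakk>z \<in> G; z \<in> Q\<rbrakk> \<Longrightarrow> norm (g z) \<le> \<tau>\<rbrakk> \<Longrightarrow> measure \<omega> Q \<le> \<epsilon>"
  using assms unfolding two_constants_property_def by (metis IntE)

lemma boundary_values_two_constants:
  assumes \<phi>: "\<phi> holomorphic_on ball 0 1" "\<phi> ` ball 0 1 \<subseteq> G"
    and \<rho>: "\<And>j::nat. 0 < \<rho> j" "\<And>j. \<rho> j < 1"
    and lim: "AE t in unit_interval. (\<lambda>j. \<phi> (circlepath 0 (\<rho> j) t)) \<longlonglongrightarrow> X t"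
    and g: "g holomorphic_on G" "\<And>z. z \<in> G \<Longrightarrow> g z \<noteq> 0 \<and> norm (g z) \<le> 1"
    and Q: "open Q" and \<tau>: "0 < \<tau>" "\<tau> < 1" "\<And>z. z \<in> G \<inter> Q \<Longrightarrow> norm (g z) \<le> \<tau>"
  shows "measure unit_interval {t \<in> {0..1}. X t \<in> Q} \<le> ln (norm (g (\<phi> 0))) / ln \<tau>"
proof -
  define Y where "Y j t = \<phi> (circlepath 0 (\<rho> j) t)" for j t
  have Y_in_G: "Y j t \<in> G" for j t using circlepath_in_ball[OF \<rho>] \<phi>(2) by (auto simp: Y_def)
  have cont: "continuous_on {0..1} (\<lambda>t. h (circlepath 0 (\<rho> j) t))" if "h holomorphic_on ball 0 1"
    for h :: "complex \<Rightarrow> complex" and j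
    using that \<rho> by (intro continuous_on_circle[of 1] holomorphic_on_imp_continuous_on)
  have g\<phi>: "(\<lambda>z. g (\<phi> z)) holomorphic_on ball 0 1"
    using holomorphic_on_compose_gen[OF \<phi>(1) g(1) \<phi>(2)] by (simp add: o_def)
  have Y_meas: "Y j \<in> borel_measurable unit_interval" for j
    unfolding Y_def by (intro borel_measurable_integrable integrable_unit_interval cont \<phi>(1))
  have "measure unit_interval {t \<in> {0..1}. Y j t \<in> Q} \<le> ln (norm (g (\<phi> 0))) / ln \<tau>" for j
  proof -
    have "(\<lambda>t. norm (g (Y j t))) \<in> borel_measurable unit_interval"
      unfolding Y_def
      by (intro borel_measurable_integrable integrable_unit_interval continuous_on_norm cont g\<phi>)
    from measurable_sets[OF this, of "{..\<tau>}"]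
    have "{t \<in> {0..1}. norm (g (Y j t)) \<le> \<tau>} \<in> sets unit_interval"
      by (simp add: vimage_def Int_def conj_commute)
    then have "measure unit_interval {t \<in> {0..1}. Y j t \<in> Q}
        \<le> measure unit_interval {t \<in> {0..1}. norm (g (Y j t)) \<le> \<tau>}"
      by (intro unit_interval.finite_measure_mono) (use \<tau>(3) Y_in_G in auto)
    also have "\<dots> \<le> ln (norm (g (\<phi> 0))) / ln \<tau>"
      unfolding Y_def
      by (rule measure_small_values_circle[OF g\<phi> _ \<rho> \<tau>(1,2)]) (use g(2) \<phi>(2) in blast)
    finally show ?thesis .
  qed
  then show ?thesis
    using unit_interval.measure_limit_in_open_le[of Y X Q, OF Y_meas _ Q] lim by (simp add: Y_def)
qed

lemma exists_harmonic_measure: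
  assumes G: "open G" "simply_connected G" "bounded G" "z0 \<in> G"
  obtains \<omega> where "prob_space \<omega>" "sets \<omega> = sets borel" "AE z in \<omega>. z \<in> frontier G"
    "two_constants_property G z0 \<omega>"
proof -
  obtain \<phi> \<rho> X where \<phi>: "\<phi> holomorphic_on ball 0 1" "\<phi> ` ball 0 1 \<subseteq> G" "\<phi> 0 = z0"
    and \<rho>: "\<And>j. 0 < \<rho> j" "\<And>j::nat. \<rho> j < 1" and X: "X \<in> borel_measurable unit_interval"
      "AE t in unit_interval. (\<lambda>j. \<phi> (circlepath 0 (\<rho> j) t)) \<longlonglongrightarrow> X t"
      "AE t in unit_interval. X t \<in> frontier G"
    by (rule Riemann_map_boundary_values[OF G]) blast
  define \<omega> where "\<omega> = distr unit_interval borel X"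
  have measure_\<omega>: "measure \<omega> Q = measure unit_interval {t \<in> {0..1}. X t \<in> Q}" if "open Q" for Q
    using X(1) that by (simp add: \<omega>_def measure_distr vimage_def Int_def conj_commute)
  have "\<exists>\<tau>>0. \<forall>g Q. g holomorphic_on G \<and> (\<forall>z\<in>G. g z \<noteq> 0 \<and> norm (g z) \<le> 1) \<and>
        a \<le> norm (g z0) \<and> open Q \<and> (\<forall>z\<in>G \<inter> Q. norm (g z) \<le> \<tau>) \<longrightarrow> measure \<omega> Q \<le> \<epsilon>"
    if a: "0 < a" and \<epsilon>: "0 < \<epsilon>" for a \<epsilon> :: real
  proof -
    define l where "l = ln (min a (1/2))"
    have l: "l < 0" using a by (simp add: l_def min_def)
    have "measure \<omega> Q \<le> \<epsilon>"
        if g: "g holomorphic_on G" "\<forall>z\<in>G. g z \<noteq> 0 \<and> norm (g z) \<le> 1" "a \<le> norm (g z0)"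
      and Q: "open Q" "\<forall>z\<in>G \<inter> Q. norm (g z) \<le> exp (l / \<epsilon>)" for g Q
    proof -
      have "measure \<omega> Q \<le> ln (norm (g z0)) / ln (exp (l / \<epsilon>))"
        unfolding measure_\<omega>[OF Q(1)] \<phi>(3)[symmetric]
        by (rule boundary_values_two_constants[OF \<phi>(1,2) \<rho> X(2) g(1)])
           (use g(2) Q l \<epsilon> in \<open>auto simp: divide_neg_pos\<close>)
      also have "\<dots> = ln (norm (g z0)) / l * \<epsilon>" by simp
      also have "\<dots> \<le> 1 * \<epsilon>"
      proof (intro mult_right_mono)
        have "l \<le> ln (norm (g z0))" unfolding l_def using a g(3) by (intro ln_mono) auto
        then show "ln (norm (g z0)) / l \<le> 1" using l by (simp add: divide_le_eq)
      qed (use \<epsilon> in simp)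
      finally show ?thesis by simp
    qed
    then show ?thesis by (intro exI[of _ "exp (l / \<epsilon>)"]) auto
  qed
  then have "two_constants_property G z0 \<omega>" unfolding two_constants_property_def by blast
  moreover have "AE z in \<omega>. z \<in> frontier G"
    unfolding \<omega>_def using X by (simp add: AE_distr_iff)
  moreover have "prob_space \<omega>" unfolding \<omega>_def by (rule unit_interval.prob_space_distr[OF X(1)])
  moreover have "sets \<omega> = sets borel" by (simp add: \<omega>_def)
  ultimately show ?thesis using that by blast
qed

section \<open>A square root barrier\<close>

lemma connected_Int_cball:
  fixes Z :: "'a::real_normed_vector set"
  assumes "connected Z" "sphere 0 S \<subseteq> Z" "0 < S"
  shows "connected (Z \<inter> cball 0 S)"
proof -
  define g where "g z = (S / max S (norm z)) *\<^sub>R z" for z :: 'a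
  have g_fix: "g z = z" if "norm z \<le> S" for z using that \<open>0 < S\<close> by (simp add: g_def)
  have g_sphere: "g z \<in> sphere 0 S" if "S < norm z" for z using that \<open>0 < S\<close> by (auto simp: g_def)
  have "g ` Z = Z \<inter> cball 0 S"
  proof
    have "g z \<in> Z \<inter> cball 0 S" if "z \<in> Z" for z
      using that g_fix[of z] g_sphere[of z] assms(2) by (cases "norm z \<le> S") auto
    then show "g ` Z \<subseteq> Z \<inter> cball 0 S" by blast
    show "Z \<inter> cball 0 S \<subseteq> g ` Z" using g_fix by (force simp: image_iff)
  qed
  moreover have "continuous_on Z g"
    unfolding g_def using \<open>0 < S\<close> by (intro continuous_intros) (auto simp: max_def)
  ultimately show ?thesis using connected_continuous_image assms(1) by metis
qed

lemma connected_components_of_top_of_set: "connected_components_of (top_of_set S) = components S"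
proof -
  have "connected_component_of (top_of_set S) x y \<longleftrightarrow> connected_component S x y" for x y
    by (auto simp: connected_component_of_def connected_component_def connectedin_subtopology)
  then have "connected_component_of (top_of_set S) = connected_component S" by (intro ext)
  then show ?thesis by (simp add: connected_components_of_def components_def)
qed

lemma component_Diff_ball_meets_sphere:
  fixes X :: "'a::metric_space set"
  assumes X: "compact X" "connected X" "X \<inter> ball a R \<noteq> {}" and C: "C \<in> components (X - ball a R)"
  obtains c where "c \<in> C" "dist a c = R"
proof -
  let ?X = "top_of_set X" and ?K = "X - ball a R"
  have "C \<in> connected_components_of (subtopology ?X ?K)"
    using C
    by (simp add: subtopology_subtopology Int_absorb1 Diff_subset
        connected_components_of_top_of_set)
  moreover have "closedin ?X ?K"
    unfolding closedin_closed by (intro exI[of _ "- ball a R"]) auto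
  ultimately have "C \<inter> ?X frontier_of ?K \<noteq> {}"
    using X
    by (intro boundary_bumping_theorem_closed)
       (auto simp: connected_space_subtopology compact_space_subtopology
           Hausdorff_space_subtopology)
  then obtain c where c: "c \<in> C" "c \<in> ?X frontier_of ?K" by blast
  have "c \<in> closure (ball a R)"
    using c(2) closure_mono[of "X \<inter> (X - ?K)" "ball a R"]
    by (auto simp: frontier_of_closures closure_of_subtopology)
  then have "dist a c \<le> R" using closure_minimal[OF ball_subset_cball closed_cball] by force
  moreover have "c \<in> ?K" using c(1) C in_components_subset by blast
  ultimately show ?thesis using that c(1) by auto
qed

lemma simply_connected_component_complement:
  fixes Y :: "complex set"
  assumes "closed Y" "connected Y" "\<not> bounded Y" "C \<in> components (- Y)"
  shows "simply_connected C"
proof -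
  have "Y \<subseteq> - C" using in_components_subset[OF assms(4)] by blast
  then have "\<not> bounded (- C)" using assms(3) bounded_subset by blast
  then have "inside C = {}"
    using component_complement_connected[OF assms(2,4)]
    by (intro inside_complement_unbounded_connected_empty)
  then show ?thesis
    using assms(1,4) open_components[of "- Y"] in_components_connected
    by (simp add: simply_connected_eq_empty_inside open_Compl)
qed

lemma continuum_from_circle_to_circle:
  fixes A :: "complex set"
  assumes A: "open A" "connected (- A)" "A \<subseteq> ball 0 S" and p: "p \<notin> A" "norm p < T"
      and T: "0 < T" "T < S"
  obtains C c where "compact C" "connected C" "C \<subseteq> cball 0 S - A - ball 0 T" "sphere 0 S \<subseteq> C"
    "c \<in> C" "norm c = T"
proof -
  define X where "X = - A \<inter> cball 0 S"
  have "sphere 0 S \<subseteq> - A" using A(3) by auto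
  then have X: "compact X" "connected X"
    unfolding X_def using A T by (auto intro!: closed_Int_compact connected_Int_cball)
  have sphere: "sphere 0 S \<subseteq> X - ball 0 T" using \<open>sphere 0 S \<subseteq> - A\<close> T(2) by (auto simp: X_def)
  have S_on_sphere: "complex_of_real S \<in> sphere 0 S" using T by simp
  define C where "C = connected_component_set (X - ball 0 T) (complex_of_real S)"
  have C: "C \<in> components (X - ball 0 T)"
    unfolding C_def using sphere S_on_sphere by (intro componentsI) blast
  have "X \<inter> ball 0 T \<noteq> {}" using p T by (auto simp: X_def)
  then obtain c where "c \<in> C" "norm c = T"
    using component_Diff_ball_meets_sphere[OF X _ C] by auto
  moreover have "compact C" using compact_components[OF compact_diff[OF X(1) open_ball] C] .
  moreover have "sphere 0 S \<subseteq> C"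
    unfolding C_def using sphere S_on_sphere
    by (intro connected_component_maximal) (auto simp: connected_sphere)
  moreover have "C \<subseteq> cball 0 S - A - ball 0 T"
    using in_components_subset[OF C] by (auto simp: X_def)
  ultimately show ?thesis using that in_components_connected[OF C] by blast
qed

lemma simply_connected_superset_of_ball:
  fixes A :: "complex set"
  assumes A: "open A" "connected A" "bounded A" "connected (- A)" and p: "p \<notin> A" "norm p < T"
    and meets: "A \<inter> ball 0 T \<noteq> {}"
  obtains \<Omega> c where "open \<Omega>" "simply_connected \<Omega>" "ball 0 T \<subseteq> \<Omega>" "A \<subseteq> \<Omega>" "c \<notin> \<Omega>" "norm c = T"
proof -
  have "0 < T" using p(2) le_less_trans[OF norm_ge_zero] by blast
  obtain S0 where "A \<subseteq> ball 0 S0" using bounded_subset_ballD[OF A(3)] by blast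
  then obtain S where S: "A \<subseteq> ball 0 S" "T < S"
    by (intro that[of "max S0 (T + 1)"]) (auto simp: subset_iff)
  obtain C c where C: "compact C" "connected C" "C \<subseteq> cball 0 S - A - ball 0 T" "sphere 0 S \<subseteq> C"
    and c: "c \<in> C" "norm c = T"
    by (rule continuum_from_circle_to_circle[OF A(1,4) S(1) p \<open>0 < T\<close> S(2)])
  define Y where "Y = C \<union> - ball 0 S"
  have "closed Y" unfolding Y_def using C(1) by (auto intro: compact_imp_closed)
  have "connected Y"
    unfolding Y_def
  proof (intro connected_Un C(2))
    show "connected (- ball (0::complex) S)" by (intro connected_complement_bounded_convex) auto
    have "complex_of_real S \<in> C \<inter> - ball 0 S" using C(4) S(2) \<open>0 < T\<close> by auto
    then show "C \<inter> - ball 0 S \<noteq> {}" by blast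
  qed
  have "\<not> bounded (- ball (0::complex) S)" by (intro cobounded_imp_unbounded) simp
  then have "\<not> bounded Y" using bounded_subset unfolding Y_def by blast
  define \<Omega> where "\<Omega> = connected_component_set (- Y) 0"
  have sub: "A \<union> ball 0 T \<subseteq> - Y" using C(3) S by (auto simp: Y_def)
  then have "0 \<in> - Y" using \<open>0 < T\<close> centre_in_ball[of 0 T] by blast
  then have comp: "\<Omega> \<in> components (- Y)" unfolding \<Omega>_def by (rule componentsI)
  have "A \<union> ball 0 T \<subseteq> \<Omega>"
    unfolding \<Omega>_def using A(2) meets sub \<open>0 < T\<close>
    by (intro connected_component_maximal connected_Un) auto
  moreover have "c \<notin> \<Omega>" using c(1) in_components_subset[OF comp] by (auto simp: Y_def)
  moreover have "open \<Omega>" using comp \<open>closed Y\<close> open_components by blast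
  ultimately show ?thesis
    using that[of \<Omega> c] c(2)
      simply_connected_component_complement[OF \<open>closed Y\<close> \<open>connected Y\<close> \<open>\<not> bounded Y\<close> comp]
    by blast
qed

lemma Re_sqrt_branch_pos:
  assumes q: "continuous_on (cball b e) q" "\<And>x. x \<in> cball b e \<Longrightarrow> (q x)\<^sup>2 = x - c"
    and e: "0 \<le> e" "e < norm (b - c)" and x: "x \<in> cball b e"
  shows "0 < Re (q x / q b)"
proof -
  define s where "s x = Re (q x / q b)" for x
  have bc: "b \<noteq> c" using e by auto
  have b: "b \<in> cball b e" using e(1) by simp
  have qb: "(q b)\<^sup>2 = b - c" "q b \<noteq> 0" using q(2)[OF b] bc by auto
  have "s y \<noteq> 0" if y: "y \<in> cball b e" for y
  proof
    assume "s y = 0"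
    then have "Re ((q y / q b)\<^sup>2) \<le> 0" unfolding s_def Re_power2 by simp
    moreover have "(q y / q b)\<^sup>2 = (y - c) / (b - c)"
      using q(2)[OF y] qb(1) by (simp add: power_divide)
    then have "(q y / q b)\<^sup>2 = 1 + (y - b) / (b - c)" using bc by (simp add: divide_simps)
    moreover have "norm ((y - b) / (b - c)) < 1"
      using y e by (simp add: dist_norm norm_minus_commute norm_divide divide_less_eq)
    then have "-1 < Re ((y - b) / (b - c))" using abs_Re_le_cmod[of "(y - b) / (b - c)"] by linarith
    ultimately show False by simp
  qed
  moreover have "connected (s ` cball b e)"
    unfolding s_def using qb(2) q(1) by (intro connected_continuous_image continuous_intros) auto
  moreover have "s b = 1" using qb(2) by (simp add: s_def)
  ultimately have "\<not> s x \<le> 0"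
    using connectedD_interval[of "s ` cball b e" "s x" "s b" 0] x b by force
  then show ?thesis by (simp add: s_def)
qed

(* If q w were close to - q b then w would be close to b, where q takes values close to q b. *)
lemma sqrt_branch_add_ge:
  fixes q :: "complex \<Rightarrow> complex"
  assumes q: "continuous_on \<Omega> q" "\<And>x. x \<in> \<Omega> \<Longrightarrow> (q x)\<^sup>2 = x - c"
    and disc: "cball b (9/16 * norm (b - c)) \<subseteq> \<Omega>" and bc: "b \<noteq> c" and w: "w \<in> \<Omega>"
  shows "norm (q b) / 4 \<le> norm (q w + q b)"
proof (rule ccontr)
  assume "\<not> ?thesis"
  then have less: "norm (q w + q b) < norm (q b) / 4" by simp
  have "b \<in> cball b (9/16 * norm (b - c))" by simp
  then have "b \<in> \<Omega>" using disc by blast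
  then have qb: "(q b)\<^sup>2 = b - c" by (rule q(2))
  then have norm_qb: "norm (q b) ^ 2 = norm (b - c)" by (metis norm_power)
  have "norm (q w - q b) \<le> norm (q w + q b) + 2 * norm (q b)"
    using norm_triangle_ineq4[of "q w + q b" "2 * q b"] by (simp add: norm_mult)
  then have "norm (q w - q b) * norm (q w + q b) \<le> (9/4 * norm (q b)) * (norm (q b) / 4)"
    using less by (intro mult_mono) auto
  then have bound: "norm ((q w - q b) * (q w + q b)) \<le> 9/16 * norm (q b) ^ 2"
    by (simp add: norm_mult power2_eq_square)
  have "(q w - q b) * (q w + q b) = (q w)\<^sup>2 - (q b)\<^sup>2" by (simp add: power2_eq_square algebra_simps)
  also have "\<dots> = w - b" using q(2)[OF w] qb by simp
  finally have "norm (w - b) \<le> 9/16 * norm (q b) ^ 2" using bound by simp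
  then have "w \<in> cball b (9/16 * norm (b - c))"
    by (simp add: norm_qb dist_norm norm_minus_commute)
  then have "0 < Re (q w / q b)"
    using disc q bc
    by (intro Re_sqrt_branch_pos[of b "9/16 * norm (b - c)"]) (auto intro: continuous_on_subset)
  then have "1 < norm (q w / q b + 1)" using complex_Re_le_cmod[of "q w / q b + 1"] by simp
  moreover have "q b \<noteq> 0" using qb bc by auto
  then have "q w + q b = q b * (q w / q b + 1)" by (simp add: field_simps)
  ultimately have "norm (q b) < norm (q w + q b)" using \<open>q b \<noteq> 0\<close> by (simp add: norm_mult)
  then show False using less norm_ge_zero[of "q b"] by linarith
qed

lemma exists_sqrt_branch:
  assumes \<Omega>: "open \<Omega>" "simply_connected \<Omega>" "ball 0 T \<subseteq> \<Omega>" "c \<notin> \<Omega>" "norm c = T"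
    and b: "norm b \<le> T / 4" and T: "T > 0"
  obtains q where "q holomorphic_on \<Omega>" "\<And>w. w \<in> \<Omega> \<Longrightarrow> (q w)\<^sup>2 = w - c"
    "\<And>w. w \<in> \<Omega> \<Longrightarrow> norm (q b) / 4 \<le> norm (q w + q b)"
proof -
  have "(\<lambda>w. w - c) holomorphic_on \<Omega> \<and> (\<forall>w\<in>\<Omega>. w - c \<noteq> 0)"
    using \<Omega>(4) by (auto intro!: holomorphic_intros)
  then obtain q where q: "q holomorphic_on \<Omega>" "\<And>w. w \<in> \<Omega> \<Longrightarrow> (q w)\<^sup>2 = w - c"
    using \<Omega>(2) simply_connected_eq_holomorphic_sqrt[OF \<Omega>(1)] by metis
  have bc: "norm (b - c) \<le> 5/4 * T" "b \<noteq> c"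
    using norm_triangle_ineq4[of b c] b \<Omega>(5) T by auto
  have disc: "cball b (9/16 * norm (b - c)) \<subseteq> \<Omega>"
  proof
    fix x assume "x \<in> cball b (9/16 * norm (b - c))"
    then have "norm x < T" using norm_le_if_mem_cball b bc(1) T by fastforce
    then show "x \<in> \<Omega>" using \<Omega>(3) by auto
  qed
  have "norm (q b) / 4 \<le> norm (q w + q b)" if "w \<in> \<Omega>" for w
    by (rule sqrt_branch_add_ge[OF holomorphic_on_imp_continuous_on[OF q(1)] q(2) disc bc(2) that])
  then show ?thesis using that q by blast
qed

lemma norm_diff_divide_add_bounds:
  fixes a p :: complex
  assumes "norm p / 4 \<le> norm (a + p)" "a + p \<noteq> 0"
  shows "norm ((a - p) / (a + p)) \<le> 9"
    and "2 * norm p \<le> norm a \<Longrightarrow> 1/3 \<le> norm ((a - p) / (a + p))"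
proof -
  have "norm (a - p) \<le> norm (a + p) + 2 * norm p"
    using norm_triangle_ineq4[of "a + p" "2 * p"] by (simp add: norm_mult)
  then have "norm (a - p) \<le> 9 * norm (a + p)" using assms(1) by linarith
  then show "norm ((a - p) / (a + p)) \<le> 9"
    using assms(2) by (simp add: norm_divide divide_le_eq)
  assume "2 * norm p \<le> norm a"
  then have "norm (a + p) \<le> 3 * norm (a - p)"
    using norm_triangle_ineq[of a p] norm_triangle_ineq2[of a p] by linarith
  then show "1/3 \<le> norm ((a - p) / (a + p))"
    using assms(2) by (simp add: norm_divide le_divide_eq)
qed

lemma exists_sqrt_barrier:
  assumes \<Omega>: "open \<Omega>" "simply_connected \<Omega>" "ball 0 T \<subseteq> \<Omega>" "c \<notin> \<Omega>" "norm c = T"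
    and b: "norm b \<le> T / 4" and T: "T > 0"
  obtains u where "u holomorphic_on \<Omega>" "\<And>w. w \<in> \<Omega> \<Longrightarrow> w \<noteq> b \<Longrightarrow> u w \<noteq> 0"
    "\<And>w. w \<in> \<Omega> \<Longrightarrow> norm (u w) \<le> 9" "\<And>w. w \<in> \<Omega> \<Longrightarrow> norm (u w) \<le> 27 * norm (w - b) / T"
    "\<And>w. w \<in> \<Omega> \<Longrightarrow> 10 * T \<le> norm w \<Longrightarrow> 1/3 \<le> norm (u w)"
proof -
  obtain q where q: "q holomorphic_on \<Omega>" "\<And>w. w \<in> \<Omega> \<Longrightarrow> (q w)\<^sup>2 = w - c"
    and low: "\<And>w. w \<in> \<Omega> \<Longrightarrow> norm (q b) / 4 \<le> norm (q w + q b)"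
    by (rule exists_sqrt_branch[OF assms]) blast
  have norm_q: "norm (q w) ^ 2 = norm (w - c)" if "w \<in> \<Omega>" for w
    using q(2)[OF that] by (metis norm_power)
  have "b \<in> \<Omega>" using \<Omega>(3) b T by auto
  have bc: "3/4 * T \<le> norm (b - c)" "norm (b - c) \<le> 5/4 * T"
    using norm_triangle_ineq4[of b c] norm_triangle_ineq2[of c b] b \<Omega>(5)
    by (auto simp: norm_minus_commute)
  then have qb: "norm (q b) > 0" using norm_q[OF \<open>b \<in> \<Omega>\<close>] T by auto
  have nz: "q w + q b \<noteq> 0" if "w \<in> \<Omega>" for w using low[OF that] qb by auto
  have diff: "(q w - q b) * (q w + q b) = w - b" if "w \<in> \<Omega>" for w
    using q(2)[OF that] q(2)[OF \<open>b \<in> \<Omega>\<close>] by algebra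
  define u where "u w = (q w - q b) / (q w + q b)" for w
  show ?thesis
  proof (rule that)
    show "u holomorphic_on \<Omega>" unfolding u_def using q(1) nz by (intro holomorphic_intros) auto
    fix w assume w: "w \<in> \<Omega>"
    show "u w \<noteq> 0" if "w \<noteq> b" using diff[OF w] nz[OF w] that by (auto simp: u_def)
    note bounds = norm_diff_divide_add_bounds[OF low[OF w] nz[OF w], folded u_def]
    show "norm (u w) \<le> 9" by (rule bounds(1))
    have "norm (u w) = norm (w - b) / norm (q w + q b) ^ 2"
      unfolding u_def diff[OF w, symmetric] norm_divide norm_mult
      using nz[OF w] by (simp add: power2_eq_square)
    also have "\<dots> \<le> norm (w - b) / (norm (q b) / 4) ^ 2"
      using low[OF w] qb by (intro divide_left_mono power_mono mult_pos_pos) auto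
    also have "\<dots> = 16 * norm (w - b) / norm (b - c)" by (simp add: power_divide norm_q[OF \<open>b \<in> \<Omega>\<close>])
    also have "\<dots> \<le> 16 * norm (w - b) / (16/27 * T)"
      using bc T by (intro divide_left_mono mult_pos_pos) auto
    finally show "norm (u w) \<le> 27 * norm (w - b) / T" by simp
    show "1/3 \<le> norm (u w)" if "10 * T \<le> norm w"
    proof -
      have "9 * T \<le> norm (w - c)" using norm_triangle_ineq2[of w c] that \<Omega>(5) by linarith
      then have "(2 * norm (q b)) ^ 2 \<le> norm (q w) ^ 2"
        using norm_q[OF w] norm_q[OF \<open>b \<in> \<Omega>\<close>] bc T by (simp add: power_mult_distrib)
      then have "2 * norm (q b) \<le> norm (q w)" by (rule power2_le_imp_le) simp
      then show ?thesis by (rule bounds(2))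
    qed
  qed
qed

section \<open>Bounded wandering domains\<close>

locale bungee_fatou_domain = log_tract +
  fixes G :: "complex set"
  assumes open_G: "open G" and connected_G: "connected G" and bounded_G: "bounded G"
    and G_subset_fatou: "G \<subseteq> fatou_set f" and G_meets_bungee: "G \<inter> bungee_set f \<noteq> {}"
    and frontier_G: "frontier G \<subseteq> julia_set f"
begin

abbreviation image_domain :: "nat \<Rightarrow> complex set" where
  "image_domain n \<equiv> (f ^^ n) ` G"

lemma G_subset_bungee: "G \<subseteq> bungee_set f"
  using G_meets_bungee fatou_domain_subset_bungee[OF entire open_G connected_G G_subset_fatou]
  by blast

lemma open_image_domain: "open (image_domain n)"
  by (rule open_funpow_image[OF open_image open_G])

lemma connected_image_domain: "connected (image_domain n)"
  by (intro connected_continuous_image continuous_funpow connected_G)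

lemma bounded_image_domain: "bounded (image_domain n)"
  by (rule bounded_continuous_image[OF continuous_funpow bounded_G])

lemma image_domain_subset_fatou: "image_domain n \<subseteq> fatou_set f"
  using G_subset_fatou funpow_in_fatou_set_iff[OF continuous_f open_image] by blast

lemma frontier_image_domain_subset_julia: "frontier (image_domain n) \<subseteq> julia_set f"
proof -
  have "frontier (image_domain n) \<subseteq> (f ^^ n) ` frontier G"
    by (rule frontier_image_subset[OF continuous_funpow bounded_G open_image_domain])
  then show ?thesis
    using frontier_G funpow_in_fatou_set_iff[OF continuous_f open_image]
    by (fastforce simp: julia_set_def)
qed

lemma connected_complement_image_domain: "connected (- image_domain n)"
  using simply_connected_fatou_domain[OF open_image_domain connected_image_domain
      image_domain_subset_fatou frontier_image_domain_subset_julia]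
    simply_connected_iff_simple[OF open_image_domain bounded_image_domain]
  by blast

lemma image_domain_subset_if_meets:
  assumes "image_domain i \<inter> image_domain j \<noteq> {}"
  shows "image_domain i \<subseteq> image_domain j"
  using connected_Int_frontier[OF connected_image_domain assms]
    image_domain_subset_fatou[of i] frontier_image_domain_subset_julia[of j]
  by (auto simp: julia_set_def)

lemma image_domain_disjoint:
  assumes "m < n"
  shows "image_domain m \<inter> image_domain n = {}"
proof (rule ccontr)
  assume "\<not> ?thesis"
  then have eq: "image_domain n = image_domain m"
    using image_domain_subset_if_meets[of m n] image_domain_subset_if_meets[of n m] by blast
  have "image_domain k \<subseteq> (\<Union>i<n. image_domain i)" for k
  proof (induction k rule: less_induct)
    case (less k)
    show ?case
    proof (cases "k < n")
      case False
      then have "image_domain k = (f ^^ (k - n)) ` image_domain n"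
        by (simp add: image_comp flip: funpow_add)
      also have "\<dots> = image_domain (k - n + m)"
        unfolding eq by (simp add: image_comp flip: funpow_add)
      also have "\<dots> \<subseteq> (\<Union>i<n. image_domain i)" using False assms by (intro less) simp
      finally show ?thesis .
    qed blast
  qed
  moreover have "bounded (\<Union>i<n. image_domain i)"
    by (intro bounded_UN ballI bounded_image_domain) simp
  then obtain K where "\<And>x. x \<in> (\<Union>i<n. image_domain i) \<Longrightarrow> norm x < K"
    unfolding bounded_pos_less by blast
  moreover obtain z where "z \<in> G" using G_meets_bungee by blast
  ultimately have "norm ((f ^^ k) z) < K" for k by blast
  then have "z \<in> bounded_orbit_set f" unfolding bounded_orbit_set_iff by blast
  then show False using \<open>z \<in> G\<close> G_subset_bungee by (auto simp: bungee_set_def)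
qed

lemma iterates_avoid_disc:
  assumes "z0 \<in> G"
  obtains \<delta> where "0 < \<delta>" "\<And>n z. \<lbrakk>0 < n; z \<in> G\<rbrakk> \<Longrightarrow> \<delta> \<le> norm ((f ^^ n) z - z0)"
proof -
  obtain \<delta> where \<delta>: "0 < \<delta>" "ball z0 \<delta> \<subseteq> G" using open_G assms open_contains_ball by blast
  have "(f ^^ n) z \<notin> ball z0 \<delta>" if "0 < n" "z \<in> G" for n z
  proof -
    have "(f ^^ n) z \<notin> G" using image_domain_disjoint[OF that(1)] that(2) by auto
    then show ?thesis using \<delta>(2) by blast
  qed
  then show ?thesis using that[OF \<delta>(1)] by (simp add: dist_norm norm_minus_commute not_less)
qed

lemma far_orbit_barrier:
  assumes z0: "z0 \<in> G" and n: "0 < n" and T: "norm \<alpha> < T" "4 * norm z0 \<le> T" "K \<le> T"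
    and far: "10 * T \<le> norm ((f ^^ n) z0)"
  obtains g where "g holomorphic_on G" "\<And>z. z \<in> G \<Longrightarrow> g z \<noteq> 0 \<and> norm (g z) \<le> 1" "1/27 \<le> norm (g z0)"
    "\<And>z. \<lbrakk>z \<in> G; norm ((f ^^ n) z) < K\<rbrakk> \<Longrightarrow> norm (g z) \<le> 3 * (K + norm z0) / T"
proof (cases "image_domain n \<inter> ball 0 T = {}")
  case True
  show ?thesis
    by (rule that[of "\<lambda>_. 1"]) (use True T(3) in \<open>force simp: disjoint_iff\<close>)+
next
  case False
  have "\<alpha> \<notin> image_domain n"
    using image_domain_subset_fatou alpha_in_julia by (auto simp: julia_set_def)
  then obtain \<Omega> c where \<Omega>: "open \<Omega>" "simply_connected \<Omega>" "ball 0 T \<subseteq> \<Omega>" "image_domain n \<subseteq> \<Omega>"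
      "c \<notin> \<Omega>" "norm c = T"
    by (rule simply_connected_superset_of_ball[OF open_image_domain connected_image_domain
          bounded_image_domain connected_complement_image_domain _ T(1) False])
  have "0 < T" using T(1) le_less_trans[OF norm_ge_zero] by blast
  moreover have "norm z0 \<le> T / 4" using T(2) by simp
  ultimately obtain u where u: "u holomorphic_on \<Omega>" "\<And>w. w \<in> \<Omega> \<Longrightarrow> w \<noteq> z0 \<Longrightarrow> u w \<noteq> 0"
      "\<And>w. w \<in> \<Omega> \<Longrightarrow> norm (u w) \<le> 9" "\<And>w. w \<in> \<Omega> \<Longrightarrow> norm (u w) \<le> 27 * norm (w - z0) / T"
      "\<And>w. w \<in> \<Omega> \<Longrightarrow> 10 * T \<le> norm w \<Longrightarrow> 1/3 \<le> norm (u w)"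
    using exists_sqrt_barrier[OF \<Omega>(1-3,5,6)] by metis
  define g where "g z = u ((f ^^ n) z) / 9" for z
  have in_\<Omega>: "(f ^^ n) z \<in> \<Omega>" if "z \<in> G" for z using \<Omega>(4) that by blast
  have avoid: "(f ^^ n) z \<noteq> z0" if "z \<in> G" for z
    using image_domain_disjoint[OF n] that z0 by auto
  show ?thesis
  proof (rule that)
    have "(u \<circ> (f ^^ n)) holomorphic_on G"
      by (rule holomorphic_on_compose_gen[OF holomorphic_on_funpow[OF entire] u(1) \<Omega>(4)])
    then show "g holomorphic_on G" unfolding g_def o_def by (intro holomorphic_intros) auto
    show "g z \<noteq> 0 \<and> norm (g z) \<le> 1" if "z \<in> G" for z
      using u(2,3)[OF in_\<Omega>[OF that]] avoid[OF that] by (simp add: g_def norm_divide)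
    show "1/27 \<le> norm (g z0)"
      using u(5)[OF in_\<Omega>[OF z0] far] by (simp add: g_def norm_divide)
    show "norm (g z) \<le> 3 * (K + norm z0) / T" if "z \<in> G" "norm ((f ^^ n) z) < K" for z
    proof -
      have "norm (g z) \<le> 3 * norm ((f ^^ n) z - z0) / T"
        using u(4)[OF in_\<Omega>[OF that(1)]] by (simp add: g_def norm_divide)
      also have "\<dots> \<le> 3 * (K + norm z0) / T"
        using norm_triangle_ineq4[of "(f ^^ n) z" z0] that(2) \<open>0 < T\<close>
        by (intro divide_right_mono) auto
      finally show ?thesis .
    qed
  qed
qed

end

locale bungee_fatou_domain_harmonic_measure = bungee_fatou_domain + prob_space \<omega>
    for \<omega> :: "complex measure" +
  fixes z0 :: complex
  assumes z0: "z0 \<in> G" and sets_\<omega>: "sets \<omega> = sets borel"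
      and two_constants: "two_constants_property G z0 \<omega>"
begin

lemma space_\<omega>: "space \<omega> = UNIV"
  using sets_eq_imp_space_eq[OF sets_\<omega>] by simp

lemma z0_bungee: "z0 \<in> bungee_set f"
  using z0 G_subset_bungee by blast

lemma open_Collect_norm_iterate_less: "open {z. norm ((f ^^ n) z) < K}"
  by (intro open_Collect_less continuous_intros continuous_funpow)

lemma open_Collect_less_norm_iterate: "open {z. K < norm ((f ^^ n) z)}"
  by (intro open_Collect_less continuous_intros continuous_funpow)

lemma exists_iterate_unlikely_small:
  assumes "0 < \<epsilon>" "0 \<le> K"
  shows "\<exists>n. prob {z. norm ((f ^^ n) z) < K} \<le> \<epsilon>"
proof -
  obtain \<tau> where \<tau>: "0 < \<tau>"
    "\<And>g Q. \<lbrakk>g holomorphic_on G; \<And>z. z \<in> G \<Longrightarrow> g z \<noteq> 0 \<and> norm (g z) \<le> 1; 1/27 \<le> norm (g z0); open Q;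
       \<And>z. \<lbrakk>z \<in> G; z \<in> Q\<rbrakk> \<Longrightarrow> norm (g z) \<le> \<tau>\<rbrakk> \<Longrightarrow> prob Q \<le> \<epsilon>"
    by (rule two_constants_propertyE[OF two_constants _ assms(1), of "1/27"]) auto
  define s where "s = 3 * (K + norm z0) / \<tau>"
  define T where "T = s + norm \<alpha> + 4 * norm z0 + K + 1"
  have "0 \<le> s" using \<tau>(1) assms(2) by (simp add: s_def)
  then have T: "norm \<alpha> < T" "4 * norm z0 \<le> T" "K \<le> T" "s \<le> T" "0 < T"
    unfolding T_def using assms(2) norm_ge_zero[of \<alpha>] norm_ge_zero[of z0] by linarith+
  have \<tau>T: "3 * (K + norm z0) / T \<le> \<tau>" using T(4,5) \<tau>(1) by (simp add: s_def field_simps)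
  obtain n where n: "10 * T + norm z0 \<le> norm ((f ^^ n) z0)"
    using z0_bungee unfolding bungee_set_iff by blast
  then have "0 < n" using T(5) by (cases n) auto
  moreover have "10 * T \<le> norm ((f ^^ n) z0)" using n norm_ge_zero[of z0] by linarith
  ultimately obtain g where g: "g holomorphic_on G" "\<And>z. z \<in> G \<Longrightarrow> g z \<noteq> 0 \<and> norm (g z) \<le> 1"
      "1/27 \<le> norm (g z0)"
      "\<And>z. \<lbrakk>z \<in> G; norm ((f ^^ n) z) < K\<rbrakk> \<Longrightarrow> norm (g z) \<le> 3 * (K + norm z0) / T"
    using far_orbit_barrier[OF z0 _ T(1-3)] by metis
  have "prob {z. norm ((f ^^ n) z) < K} \<le> \<epsilon>"
    by (rule \<tau>(2)[OF g(1-3) open_Collect_norm_iterate_less])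
       (use order_trans[OF g(4) \<tau>T] in blast)+
  then show ?thesis ..
qed

lemma AE_not_bounded_orbit: "AE z in \<omega>. z \<notin> bounded_orbit_set f"
proof -
  have "\<exists>n. prob {z. norm ((f ^^ n) z) < real k} \<le> (1/2) ^ k" for k
    by (rule exists_iterate_unlikely_small) auto
  then obtain n where n: "\<And>k. prob {z. norm ((f ^^ n k) z) < real k} \<le> (1/2) ^ k" by metis
  define D where "D k = {z. norm ((f ^^ n k) z) < real k}" for k
  have "AE z in \<omega>. \<forall>\<^sub>F k in sequentially. z \<in> space \<omega> - D k"
  proof (rule borel_cantelli_AE1)
    show "D k \<in> sets \<omega>" for k
      unfolding D_def sets_\<omega> by (intro borel_open open_Collect_norm_iterate_less)
    show "summable (\<lambda>k. prob (D k))"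
      by (rule summable_comparison_test'[OF summable_geometric[of "1/2 :: real"], of 0])
         (use n in \<open>auto simp: D_def\<close>)
  qed (simp add: less_top[symmetric])
  then show ?thesis
  proof eventually_elim
    case (elim z)
    have "\<exists>n. K \<le> norm ((f ^^ n) z)" for K
    proof -
      obtain N where N: "\<And>k. k \<ge> N \<Longrightarrow> z \<notin> D k" using elim unfolding eventually_sequentially by blast
      obtain k where "K \<le> real k" using real_arch_simple by blast
      then have "K \<le> norm ((f ^^ n (max k N)) z)" using N[of "max k N"] by (simp add: D_def)
      then show ?thesis ..
    qed
    then show ?case unfolding bounded_orbit_set_iff by (meson not_le)
  qed
qed

lemma frequently_unlikely_large:
  assumes "0 < \<epsilon>"
  obtains R where "\<exists>\<^sub>F n in sequentially. prob {z. R < norm ((f ^^ n) z)} \<le> \<epsilon>"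
proof -
  obtain \<delta> where \<delta>: "0 < \<delta>" and away: "\<And>n z. \<lbrakk>0 < n; z \<in> G\<rbrakk> \<Longrightarrow> \<delta> \<le> norm ((f ^^ n) z - z0)"
    using iterates_avoid_disc[OF z0] by metis
  obtain K where K: "\<exists>\<^sub>F n in sequentially. norm ((f ^^ n) z0) < K"
    using z0_bungee unfolding bungee_set_iff by blast
  then obtain m where "norm ((f ^^ m) z0) < K" using frequently_ex by blast
  then have "0 < K" using le_less_trans[OF norm_ge_zero] by blast
  define M where "M = K + norm z0"
  have "0 < M" unfolding M_def using \<open>0 < K\<close> by (simp add: add_pos_nonneg)
  obtain \<tau> where \<tau>: "0 < \<tau>"
    "\<And>g Q. \<lbrakk>g holomorphic_on G; \<And>z. z \<in> G \<Longrightarrow> g z \<noteq> 0 \<and> norm (g z) \<le> 1; \<delta> / M \<le> norm (g z0); open Q;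
       \<And>z. \<lbrakk>z \<in> G; z \<in> Q\<rbrakk> \<Longrightarrow> norm (g z) \<le> \<tau>\<rbrakk> \<Longrightarrow> prob Q \<le> \<epsilon>"
    by (rule two_constants_propertyE[OF two_constants _ assms, of "\<delta> / M"]) (use \<delta> \<open>0 < M\<close> in auto)
  have unlikely: "prob {z. \<delta> / \<tau> + norm z0 < norm ((f ^^ n) z)} \<le> \<epsilon>"
    if "0 < n" and near: "norm ((f ^^ n) z0) < K" for n
  proof (rule \<tau>(2)[of "\<lambda>z. of_real \<delta> / ((f ^^ n) z - z0)"])
    have nz: "(f ^^ n) z - z0 \<noteq> 0" if "z \<in> G" for z using away[OF \<open>0 < n\<close> that] \<delta> by auto
    then show "(\<lambda>z. of_real \<delta> / ((f ^^ n) z - z0)) holomorphic_on G"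
      by (intro holomorphic_intros holomorphic_on_funpow[OF entire]) auto
    show "of_real \<delta> / ((f ^^ n) z - z0) \<noteq> 0 \<and> norm (of_real \<delta> / ((f ^^ n) z - z0)) \<le> 1"
        if "z \<in> G" for z
      using nz[OF that] away[OF \<open>0 < n\<close> that] \<delta> by (simp add: norm_divide)
    have "norm ((f ^^ n) z0 - z0) \<le> M"
      using norm_triangle_ineq4[of "(f ^^ n) z0" z0] near by (simp add: M_def)
    then show "\<delta> / M \<le> norm (of_real \<delta> / ((f ^^ n) z0 - z0))"
      using nz[OF z0] \<delta> \<open>0 < M\<close> by (simp add: norm_divide frac_le)
    show "norm (of_real \<delta> / ((f ^^ n) z - z0)) \<le> \<tau>"
      if "z \<in> G" "z \<in> {z. \<delta> / \<tau> + norm z0 < norm ((f ^^ n) z)}" for z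
    proof -
      have "\<delta> / \<tau> \<le> norm ((f ^^ n) z - z0)"
        using norm_triangle_ineq2[of "(f ^^ n) z" z0] that(2) by simp
      then show ?thesis using nz[OF that(1)] \<delta> \<tau>(1) by (simp add: norm_divide field_simps)
    qed
  qed (rule open_Collect_less_norm_iterate)
  have "\<exists>\<^sub>F n in sequentially. 0 < n \<and> norm ((f ^^ n) z0) < K"
    using frequently_eventually_frequently[OF K eventually_gt_at_top[of 0]]
    by (simp add: conj_commute)
  then have "\<exists>\<^sub>F n in sequentially. prob {z. \<delta> / \<tau> + norm z0 < norm ((f ^^ n) z)} \<le> \<epsilon>"
    by (rule frequently_elim1) (use unlikely in blast)
  then show ?thesis by (rule that)
qed

lemma escaping_set_measurable: "escaping_set f \<in> sets \<omega>"
proof -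
  have "(\<forall>K. \<forall>\<^sub>F n in sequentially. K \<le> norm ((f ^^ n) z)) \<longleftrightarrow>
      (\<forall>k::nat. \<forall>\<^sub>F n in sequentially. real k \<le> norm ((f ^^ n) z))" for z
    by (meson eventually_mono order_trans real_arch_simple)
  then have "escaping_set f =
      {z \<in> space borel. \<forall>k::nat. \<forall>\<^sub>F n in sequentially. real k \<le> norm ((f ^^ n) z)}"
    by (auto simp: escaping_set_iff)
  moreover have "(f ^^ n) \<in> borel_measurable borel" for n
    by (rule borel_measurable_continuous_onI[OF continuous_funpow])
  ultimately show ?thesis by (simp add: sets_\<omega>)
qed

lemma AE_not_escaping: "AE z in \<omega>. z \<notin> escaping_set f"
proof -
  have "prob (escaping_set f) \<le> 0 + \<epsilon>" if \<epsilon>: "0 < \<epsilon>" for \<epsilon>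
  proof -
    obtain R where R: "\<exists>\<^sub>F n in sequentially. prob {z. R < norm ((f ^^ n) z)} \<le> \<epsilon>"
      using frequently_unlikely_large[OF \<epsilon>] .
    define Q where "Q n = {z. R < norm ((f ^^ n) z)}" for n
    have Q: "Q n \<in> sets \<omega>" for n
      unfolding Q_def sets_\<omega> by (intro borel_open open_Collect_less_norm_iterate)
    have "\<forall>\<^sub>F n in sequentially. z \<in> Q n" if "z \<in> escaping_set f" for z
    proof -
      have "\<forall>\<^sub>F n in sequentially. R + 1 \<le> norm ((f ^^ n) z)"
        using that by (simp add: escaping_set_iff)
      then show ?thesis by eventually_elim (simp add: Q_def)
    qed
    moreover have "{z \<in> space \<omega>. \<forall>\<^sub>F n in sequentially. z \<in> Q n} \<in> sets \<omega>" using Q by measurable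
    ultimately have "prob (escaping_set f) \<le> prob {z \<in> space \<omega>. \<forall>\<^sub>F n in sequentially. z \<in> Q n}"
      by (intro finite_measure_mono) (auto simp: space_\<omega>)
    also have "\<dots> \<le> \<epsilon>" using R Q by (intro measure_eventually_le) (auto simp: Q_def)
    finally show ?thesis by simp
  qed
  then have "prob (escaping_set f) \<le> 0" by (rule field_le_epsilon)
  then have "escaping_set f \<in> null_sets \<omega>"
    using escaping_set_measurable by (simp add: null_sets_def emeasure_eq_measure measure_le_0_iff)
  then show ?thesis by (rule AE_not_in)
qed

lemma AE_in_bungee_set: "AE z in \<omega>. z \<in> bungee_set f"
  using AE_not_bounded_orbit AE_not_escaping by eventually_elim (simp add: bungee_set_def)

end

context bungee_fatou_domain begin

lemma frontier_G_meets_bungee: "frontier G \<inter> bungee_set f \<noteq> {}"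
proof
  assume empty: "frontier G \<inter> bungee_set f = {}"
  obtain z0 where z0: "z0 \<in> G" using G_meets_bungee by blast
  have "simply_connected G"
    by (rule simply_connected_fatou_domain[OF open_G connected_G G_subset_fatou frontier_G])
  from exists_harmonic_measure[OF open_G this bounded_G z0]
  obtain \<omega> where \<omega>: "prob_space \<omega>" "sets \<omega> = sets borel" "AE z in \<omega>. z \<in> frontier G"
      "two_constants_property G z0 \<omega>" .
  interpret prob_space \<omega> by fact
  interpret bungee_fatou_domain_harmonic_measure f \<alpha> r U G \<omega> z0
    by unfold_locales (fact z0 \<omega>)+
  have "AE z in \<omega>. False"
    using \<omega>(3) AE_in_bungee_set by eventually_elim (use empty in blast)
  then show False by simp
qed

end

lemma (in log_tract) frontier_meets_bungee:
  assumes G: "open G" "bounded G" "G \<inter> bungee_set f \<noteq> {}"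
  shows "frontier G \<inter> bungee_set f \<noteq> {}"
proof
  assume empty: "frontier G \<inter> bungee_set f = {}"
  then have "G \<inter> julia_set f = {}" using julia_frontier_meets_bungee[OF G(1,2)] by blast
  then have fatou: "G \<subseteq> fatou_set f" by (auto simp: julia_set_def)
  obtain z where z: "z \<in> G" "z \<in> bungee_set f" using G(3) by blast
  define V where "V = connected_component_set G z"
  have V: "open V" "connected V" "V \<subseteq> G" "z \<in> V"
    unfolding V_def
    using G(1) z(1) by (auto simp: open_connected_component connected_component_subset)
  have "frontier V \<subseteq> frontier G"
    unfolding V_def by (rule frontier_of_connected_component_subset)
  then have frontier_V: "frontier V \<inter> bungee_set f = {}" using empty by blast
  interpret bungee_fatou_domain f \<alpha> r U V
  proof unfold_locales
    show "bounded V" using V(3) G(2) bounded_subset by blast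
    show "V \<subseteq> fatou_set f" using V(3) fatou by blast
    then show "frontier V \<subseteq> julia_set f"
      using frontier_fatou_domain_Int_fatou_subset_bungee[OF entire V(1,2) _ V(4) z(2)] frontier_V
      by (auto simp: julia_set_def)
  qed (use V z in auto)
  show False using frontier_G_meets_bungee frontier_V by blast
qed

section \<open>Connectedness in the Riemann sphere\<close>

lemma continuous_on_sphere_of: "continuous_on S sphere_of"
proof -
  have "1 + (cmod z)\<^sup>2 \<noteq> 0" "(cmod z)\<^sup>2 + 1 \<noteq> 0" for z :: complex
    using zero_le_power2[of "cmod z"] by linarith+
  then show ?thesis unfolding sphere_of_def[abs_def] by (intro continuous_intros) auto
qed

lemma tendsto_sphere_of_at_infinity: "(sphere_of \<longlongrightarrow> sphere_infinity) at_infinity"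
proof -
  have norm_at_top: "filterlim (norm :: complex \<Rightarrow> real) at_top at_infinity"
    by (rule filterlim_norm_at_top)
  have "((\<lambda>x::real. \<bar>2 / (1 + x\<^sup>2)\<bar> * x) \<longlongrightarrow> 0) at_top" by real_asymp
  from filterlim_compose[OF this norm_at_top]
  have "((\<lambda>z. norm (of_real (2 / (1 + (cmod z)\<^sup>2)) * z)) \<longlongrightarrow> 0) at_infinity"
    by (simp only: norm_mult norm_of_real)
  then have "((\<lambda>z. of_real (2 / (1 + (cmod z)\<^sup>2)) * z) \<longlongrightarrow> 0) at_infinity"
    by (rule tendsto_norm_zero_cancel)
  moreover have "((\<lambda>x::real. (x\<^sup>2 - 1) / (x\<^sup>2 + 1)) \<longlongrightarrow> 1) at_top" by real_asymp
  then have "((\<lambda>z. ((cmod z)\<^sup>2 - 1) / ((cmod z)\<^sup>2 + 1)) \<longlongrightarrow> 1) at_infinity"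
    by (rule filterlim_compose[OF _ norm_at_top])
  ultimately show ?thesis
    unfolding sphere_of_def[abs_def] sphere_infinity_def by (rule tendsto_Pair)
qed

lemma separating_bounded_open_set:
  assumes A: "open A" "sphere_infinity \<in> A" and B: "open B"
    and S: "sphere_of ` S \<subseteq> A \<union> B" "A \<inter> B \<inter> sphere_of ` S = {}"
  obtains G where "open G" "bounded G" "S \<inter> sphere_of -` B \<subseteq> G" "frontier G \<inter> S = {}"
proof -
  have "\<forall>\<^sub>F z in at_infinity. sphere_of z \<in> A"
    using topological_tendstoD[OF tendsto_sphere_of_at_infinity A] .
  then obtain R where R: "\<And>z. R \<le> norm z \<Longrightarrow> sphere_of z \<in> A" by (auto simp: eventually_at_infinity)
  define P where "P = (S \<inter> sphere_of -` A) \<union> - ball 0 (R + 1)"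
  define Q where "Q = S \<inter> sphere_of -` B"
  have Q_R: "Q \<subseteq> ball 0 R" using R S(2) by (force simp: Q_def not_le)
  have opA: "open (sphere_of -` A)" and opB: "open (sphere_of -` B)"
    using open_vimage continuous_on_sphere_of A(1) B by blast+
  have "sphere_of -` A \<inter> Q = {}" using S(2) unfolding Q_def by blast
  then have "sphere_of -` A \<inter> closure Q = {}" using open_Int_closure_eq_empty[OF opA] by blast
  moreover have "closure Q \<subseteq> cball 0 R" using Q_R by (intro closure_minimal) auto
  ultimately have PQ: "P \<inter> closure Q = {}" by (force simp: P_def)
  have "(sphere_of -` B \<inter> ball 0 (R + 1)) \<inter> P = {}" using S(2) unfolding P_def by blast
  then have "(sphere_of -` B \<inter> ball 0 (R + 1)) \<inter> closure P = {}"
    using open_Int_closure_eq_empty[OF open_Int[OF opB open_ball]] by blast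
  moreover have "Q \<subseteq> ball 0 (R + 1)" using Q_R by (rule order_trans) (simp add: subset_ball)
  moreover have "Q \<subseteq> sphere_of -` B" by (simp add: Q_def)
  ultimately have QP: "Q \<inter> closure P = {}" by blast
  obtain G V where G: "open G" "open V" "G \<inter> V = {}" "Q \<subseteq> G" "P \<subseteq> V"
    using separation_closures[OF QP PQ] by metis
  have "closure G \<inter> V = {}" using G(2,3) open_Int_closure_eq_empty[OF G(2), of G] by blast
  then have "frontier G \<inter> (P \<union> Q) = {}" using G by (auto simp: frontier_def interior_open)
  moreover have "S \<subseteq> P \<union> Q" using S(1) by (auto simp: P_def Q_def)
  moreover have "G \<subseteq> ball 0 (R + 1)" using G(3,5) by (auto simp: P_def)
  then have "bounded G" using bounded_ball bounded_subset by blast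
  ultimately show ?thesis using that[of G] G(1,4) by (auto simp: Q_def)
qed

lemma connected_insert_sphere_infinity:
  assumes frontier: "\<And>G. \<lbrakk>open G; bounded G; G \<inter> S \<noteq> {}\<rbrakk> \<Longrightarrow> frontier G \<inter> S \<noteq> {}"
  shows "connected (insert sphere_infinity (sphere_of ` S))"
proof (rule connectedI)
  have separation_at_infinity: False
    if A: "open A" "sphere_infinity \<in> A" and B: "open B"
      and cover: "insert sphere_infinity (sphere_of ` S) \<subseteq> A \<union> B"
      and disjoint: "A \<inter> B \<inter> insert sphere_infinity (sphere_of ` S) = {}"
      and meets: "B \<inter> insert sphere_infinity (sphere_of ` S) \<noteq> {}" for A B
  proof -
    have "sphere_of ` S \<subseteq> A \<union> B" "A \<inter> B \<inter> sphere_of ` S = {}" using cover disjoint by blast+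
    then obtain G where G: "open G" "bounded G" "S \<inter> sphere_of -` B \<subseteq> G" "frontier G \<inter> S = {}"
      by (rule separating_bounded_open_set[OF A B])
    moreover have "S \<inter> sphere_of -` B \<noteq> {}" using meets disjoint A(2) by blast
    ultimately show False using frontier[of G] by blast
  qed
  fix A B
  assume AB: "open A" "open B" "A \<inter> insert sphere_infinity (sphere_of ` S) \<noteq> {}"
      "B \<inter> insert sphere_infinity (sphere_of ` S) \<noteq> {}"
      "insert sphere_infinity (sphere_of ` S) \<subseteq> A \<union> B"
      "A \<inter> B \<inter> insert sphere_infinity (sphere_of ` S) = {}"
  then consider "sphere_infinity \<in> A" | "sphere_infinity \<in> B" by blast
  then show False
  proof cases
    case 1
    then show ?thesis using separation_at_infinity[of A B] AB by blast
  next
    case 2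
    then show ?thesis using separation_at_infinity[of B A] AB by (simp add: Un_commute Int_commute)
  qed
qed

theorem theorem1p3:
  fixes f :: "complex \<Rightarrow> complex" and \<alpha> :: complex
  assumes "transcendental_entire f"
    and "finite_log_asymptotic_value f \<alpha>"
    and "\<alpha> \<in> julia_set f"
  shows "connected (insert sphere_infinity (sphere_of ` bungee_set f))"
proof -
  obtain r U where "log_tract f \<alpha> r U" by (rule exists_log_tract[OF assms])
  then interpret log_tract f \<alpha> r U .
  show ?thesis using frontier_meets_bungee by (rule connected_insert_sphere_infinity)
qed

end
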